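(* Let $\gamma$ be a smooth closed planar curve with strictly positive curvature bounding a convex region, let $(M_i)_{i\ge 0}$ and $(N_i)_{i\ge 1}$ be the sequences of iterated involutes associated with $\gamma$, and let $O(\gamma)=\bigcap_{i\ge 0}\overline{M_i}\cap\bigcap_{i\ge 1}\overline{N_i}$. Then $O(\gamma)$ consists of a unique point, and the curves $M_i$ and $N_i$ (as parameterized curves $\theta\mapsto M_i(\theta)$, $\theta\mapsto N_i(\theta)$) converge, as $i\to\infty$, to the constant curve $O(\gamma)$ in the $C^\infty$ topology.
   Context: $[w_1,w_2]$ denotes the determinant of the $2\times 2$ matrix with columns $w_1,w_2\in\mathbb{R}^2$, and $e_\theta=(-\sin\theta,\cos\theta)$. The curve $\gamma$ is parameterized by $\theta$ ($2\pi$-periodically) so that $\gamma'(\theta)$ is a positive multiple of $e_\theta$. Put $M(\theta)=\frac12(\gamma(\theta)+\gamma(\theta+\pi))$ (the area evolute of $\gamma$). Fix $k>0$ and put $u(\theta)=\frac{k}{2}(\gamma(\theta)-\gamma(\theta+\pi))$; $u$ is a smooth convex curve, symmetric about the origin ($u(\theta+\pi)=-u(\theta)$), with strictly positive curvature, and $u'(\theta)$ is a positive multiple of $e_\theta$. Put $v(\theta)=u'(\theta)/[u(\theta),u'(\theta)]$; $v$ is also a smooth convex origin-symmetric curve, $[u,v]=1$ and $u=-v'/[v,v']$. Iterated involutes: $M_0=M$, and $\alpha_0$ is the function with $M_0'=\alpha_0u'$. Inductively, for $i\ge 0$, $$\beta_{i+1}(\theta)=\tfrac12\int_\theta^{\theta+\pi}\alpha_i[u,u']\,ds,\qquad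 N_{i+1}=M_i+\beta_{i+1}v,$$ and for $i\ge 1$, $$\alpha_i(\theta)=-\tfrac12\int_\theta^{\theta+\pi}\beta_i[v,v']\,ds,\qquad M_i=N_i+\alpha_iu.$$ One has $M_i'=\alpha_iu'$ and $N_i'=\beta_iv'$. For a closed curve $K$ among the $M_i$, $N_i$, the region $\overline{K}$ bounded by $K$ is the complement of the exterior of $K$, where the exterior is the unbounded connected component of the complement of (the image of) $K$ in $\mathbb{R}^2$. Convergence in the $C^\infty$ topology means uniform convergence in $\theta$ of the functions and of their derivatives of every order. *)

theory Defs
  imports "HOL-Analysis.Analysis"
begin

section \<open>Planar curves\<close>

definition det2 :: "real ^ 2 \<Rightarrow> real ^ 2 \<Rightarrow> real" where
  "det2 w1 w2 = det (transpose (vector [w1, w2] :: real ^ 2 ^ 2))"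

lemma det2_eq: "det2 w1 w2 = w1 $ 1 * w2 $ 2 - w2 $ 1 * w1 $ 2"
  by (simp add: det2_def det_2 transpose_def)

definition e_dir :: "real \<Rightarrow> real ^ 2" where
  "e_dir \<theta> = vector [- sin \<theta>, cos \<theta>]"

definition velocity :: "(real \<Rightarrow> 'a::real_normed_vector) \<Rightarrow> real \<Rightarrow> 'a" where
  "velocity f t = vector_derivative f (at t)"

definition nth_derivative :: "nat \<Rightarrow> (real \<Rightarrow> 'a::real_normed_vector) \<Rightarrow> real \<Rightarrow> 'a" where
  "nth_derivative n = velocity ^^ n"

definition smooth :: "(real \<Rightarrow> 'a::real_normed_vector) \<Rightarrow> bool" where
  "smooth f \<longleftrightarrow> (\<forall>n t. nth_derivative n f differentiable (at t))"

definition curvature :: "(real \<Rightarrow> real ^ 2) \<Rightarrow> real \<Rightarrow> real" where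
  "curvature c t = det2 (velocity c t) (velocity (velocity c) t) / norm (velocity c t) ^ 3"

text \<open>
  The image of a periodic continuous curve is compact, so the complement of its image has
  exactly one unbounded component, and this component is \<^const>\<open>outside\<close> of the image.
\<close>

definition region_bounded_by :: "(real \<Rightarrow> real ^ 2) \<Rightarrow> (real ^ 2) set" where
  "region_bounded_by c = - outside (range c)"

text \<open>
  Smoothness of the members of the sequence is required because \<^const>\<open>vector_derivative\<close>
  has an unspecified value where the function is not differentiable.
\<close>

definition Cinf_converges ::
    "(nat \<Rightarrow> real \<Rightarrow> 'a::real_normed_vector) \<Rightarrow> (real \<Rightarrow> 'a) \<Rightarrow> bool" where
  "Cinf_converges F f \<longleftrightarrow>
     (\<forall>i. smooth (F i)) \<and> smooth f \<and>
     (\<forall>n. uniform_limit UNIV (\<lambda>i. nth_derivative n (F i)) (nth_derivative n f) sequentially)"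

section \<open>Iterated involutes\<close>

definition area_evolute :: "(real \<Rightarrow> real ^ 2) \<Rightarrow> real \<Rightarrow> real ^ 2" where
  "area_evolute \<gamma> \<theta> = (1 / 2) *\<^sub>R (\<gamma> \<theta> + \<gamma> (\<theta> + pi))"

definition u_curve :: "(real \<Rightarrow> real ^ 2) \<Rightarrow> real \<Rightarrow> real \<Rightarrow> real ^ 2" where
  "u_curve \<gamma> k \<theta> = (k / 2) *\<^sub>R (\<gamma> \<theta> - \<gamma> (\<theta> + pi))"

definition v_curve :: "(real \<Rightarrow> real ^ 2) \<Rightarrow> real \<Rightarrow> real \<Rightarrow> real ^ 2" where
  "v_curve \<gamma> k \<theta> =
     (1 / det2 (u_curve \<gamma> k \<theta>) (velocity (u_curve \<gamma> k) \<theta>)) *\<^sub>R velocity (u_curve \<gamma> k) \<theta>"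

text \<open>
  The sequences \<open>\<beta>\<close> and \<open>N\<close> start at index 1; their values at index 0 are left unspecified.
\<close>

function alpha :: "(real \<Rightarrow> real ^ 2) \<Rightarrow> real \<Rightarrow> nat \<Rightarrow> real \<Rightarrow> real"
  and beta :: "(real \<Rightarrow> real ^ 2) \<Rightarrow> real \<Rightarrow> nat \<Rightarrow> real \<Rightarrow> real" where
  "alpha \<gamma> k 0 = (\<lambda>\<theta>. THE a. velocity (area_evolute \<gamma>) \<theta> = a *\<^sub>R velocity (u_curve \<gamma> k) \<theta>)"
| "alpha \<gamma> k (Suc i) = (\<lambda>\<theta>. - (1 / 2) * integral {\<theta>..\<theta> + pi}
     (\<lambda>s. beta \<gamma> k (Suc i) s * det2 (v_curve \<gamma> k s) (velocity (v_curve \<gamma> k) s)))"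
| "beta \<gamma> k 0 = undefined"
| "beta \<gamma> k (Suc i) = (\<lambda>\<theta>. (1 / 2) * integral {\<theta>..\<theta> + pi}
     (\<lambda>s. alpha \<gamma> k i s * det2 (u_curve \<gamma> k s) (velocity (u_curve \<gamma> k) s)))"
  by pat_completeness auto
termination
  by (relation "Wellfounded.measure (case_sum (\<lambda>(\<gamma>, k, i). 2 * i + 1) (\<lambda>(\<gamma>, k, i). 2 * i))") auto

function M_inv :: "(real \<Rightarrow> real ^ 2) \<Rightarrow> real \<Rightarrow> nat \<Rightarrow> real \<Rightarrow> real ^ 2"
  and N_inv :: "(real \<Rightarrow> real ^ 2) \<Rightarrow> real \<Rightarrow> nat \<Rightarrow> real \<Rightarrow> real ^ 2" where
  "M_inv \<gamma> k 0 = area_evolute \<gamma>"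
| "M_inv \<gamma> k (Suc i) =
     (\<lambda>\<theta>. N_inv \<gamma> k (Suc i) \<theta> + alpha \<gamma> k (Suc i) \<theta> *\<^sub>R u_curve \<gamma> k \<theta>)"
| "N_inv \<gamma> k 0 = undefined"
| "N_inv \<gamma> k (Suc i) =
     (\<lambda>\<theta>. M_inv \<gamma> k i \<theta> + beta \<gamma> k (Suc i) \<theta> *\<^sub>R v_curve \<gamma> k \<theta>)"
  by pat_completeness auto
termination
  by (relation "Wellfounded.measure (case_sum (\<lambda>(\<gamma>, k, i). 2 * i + 1) (\<lambda>(\<gamma>, k, i). 2 * i))") auto

definition O_set :: "(real \<Rightarrow> real ^ 2) \<Rightarrow> real \<Rightarrow> (real ^ 2) set" where
  "O_set \<gamma> k = (\<Inter>i. region_bounded_by (M_inv \<gamma> k i)) \<inter>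
               (\<Inter>i\<in>{1..}. region_bounded_by (N_inv \<gamma> k i))"

end

theory Submission
  imports Defs
begin

text \<open>
  With \<open>w = [u, u']\<close> and \<open>z = [v, v']\<close> one has \<open>u' = w v\<close> and \<open>v' = - z u\<close>, and the coefficients satisfy
  \<open>\<beta>\<^sub>i\<^sub>+\<^sub>1' = - w \<alpha>\<^sub>i\<close> and \<open>\<alpha>\<^sub>i' = z \<beta>\<^sub>i\<close>. So passing from \<open>\<alpha>\<^sub>i\<close> to \<open>\<alpha>\<^sub>i\<^sub>+\<^sub>1\<close> inverts the antiperiodic
  Sturm--Liouville operator \<open>y \<mapsto> - (y' / z)' / w\<close>. Its least eigenvalue 1 has the components of \<open>v\<close>
  as eigenfunctions, and \<open>\<alpha>\<^sub>i\<close> is orthogonal to them because \<open>M\<^sub>i\<close> is a closed curve. The spectral gap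
  above 1 makes the coefficients decay geometrically, and differentiating the recursion carries this
  over to all derivatives, which gives a limit point \<open>p\<close>. The function \<open>[M\<^sub>i - p, v]\<close> is again
  orthogonal to \<open>v\<close>, so it has more than one zero modulo \<open>pi\<close>: more than one tangent line of
  \<open>M\<^sub>i\<close> passes through \<open>p\<close>, whereas exactly one passes through each exterior point. Exchanging
  \<open>(u, v, w, z)\<close> for \<open>(v, - u, z, w)\<close> gives the same for the curves \<open>N\<^sub>i\<close>.
\<close>

section \<open>The planar determinant\<close>

text \<open>The gap is obtained by comparison, not by an eigenfunction expansion. An antiperiodic
  \<open>y\<close> has a zero \<open>c\<close>, and up to scale exactly one eigenfunction,
  \<open>[v c, v]\<close>, vanishes there too. Against this one the boundary terms of Picone's
  identity disappear, and the excess of the dual energy over the energy controls the distance of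
  \<open>y\<close> from a multiple of it; orthogonality rules out such a multiple. The gap compares
  \<open>\<alpha> (Suc i)\<close> only with its own derivative. It becomes decay because integration
  by parts turns the dual energy of \<open>\<beta> (Suc i)\<close> into the mixed integral of
  \<open>\<alpha> i\<close> and \<open>\<alpha> (Suc i)\<close>. For the intersection, uniqueness
  follows from uniform convergence alone: the curves shrink into every ball around the limit. The
  difficulty is that the limit belongs to every region, since the curves may be singular and
  self-intersecting. Nesting of the regions is never shown; membership is tested for each curve
  separately by counting tangent lines.\<close>

lemma bounded_bilinear_det2: "bounded_bilinear det2"
  unfolding bilinear_conv_bounded_bilinear [symmetric] bilinear_def
  by (auto intro!: linearI simp: det2_eq algebra_simps)

lemmas det2_has_vector_derivative =
  bounded_bilinear.has_vector_derivative [OF bounded_bilinear_det2]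

lemma det2_continuous_on [continuous_intros]:
  "continuous_on S f \<Longrightarrow> continuous_on S g \<Longrightarrow> continuous_on S (\<lambda>t. det2 (f t) (g t))"
  by (rule bounded_bilinear.continuous_on [OF bounded_bilinear_det2])

lemmas det2_linear_simps [simp] =
  bounded_bilinear.add_left [OF bounded_bilinear_det2]
  bounded_bilinear.add_right [OF bounded_bilinear_det2]
  bounded_bilinear.diff_left [OF bounded_bilinear_det2]
  bounded_bilinear.diff_right [OF bounded_bilinear_det2]
  bounded_bilinear.minus_left [OF bounded_bilinear_det2]
  bounded_bilinear.minus_right [OF bounded_bilinear_det2]
  bounded_bilinear.zero_left [OF bounded_bilinear_det2]
  bounded_bilinear.zero_right [OF bounded_bilinear_det2]
  bounded_bilinear.scaleR_left [OF bounded_bilinear_det2]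
  bounded_bilinear.scaleR_right [OF bounded_bilinear_det2]

lemma det2_self [simp]: "det2 x x = 0"
  by (simp add: det2_eq)

lemma det2_swap: "det2 y x = - det2 x y"
  by (simp add: det2_eq)

lemma abs_det2_le: "\<bar>det2 x y\<bar> \<le> 2 * norm x * norm y"
proof -
  have "\<bar>x $ i * y $ j\<bar> \<le> norm x * norm y" for i j
    unfolding abs_mult by (intro mult_mono component_le_norm_cart) auto
  from this[of 1 2] this[of 2 1] show ?thesis
    unfolding det2_eq mult.commute[of "y $ 1"] by linarith
qed

lemma det2_decompose:
  assumes "det2 u v = 1" shows "x = det2 x v *\<^sub>R u + det2 u x *\<^sub>R v"
proof -
  have *: "u $ 1 * v $ 2 = 1 + v $ 1 * u $ 2"
    using assms by (simp add: det2_eq)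
  have "x $ 1 = x $ 1 * (u $ 1 * v $ 2) - x $ 1 * (v $ 1 * u $ 2)"
    "x $ 2 = x $ 2 * (u $ 1 * v $ 2) - x $ 2 * (v $ 1 * u $ 2)"
    by (simp_all add: * algebra_simps)
  then show ?thesis
    by (simp add: vec_eq_iff forall_2 det2_eq algebra_simps)
qed

lemma det2_eq_zero_imp_eq:
  assumes "det2 u v = 1" "det2 (x - y) u = 0" "det2 (x - y) v = 0"
  shows "x = y"
proof -
  have "det2 u (x - y) = 0"
    using assms(2) det2_swap by (metis neg_0_equal_iff_equal)
  then have "x - y = 0"
    using det2_decompose[OF assms(1), of "x - y"] unfolding assms(3) by (simp del: det2_linear_simps)
  then show ?thesis by simp
qed

text \<open>With \<open>[a, b] = 1\<close> this plays the part of the addition theorem for the sine: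
  it relates determinants taken at two parameters to components in a fixed basis.\<close>

lemma det2_pluecker:
  "det2 a b * det2 c d = det2 a c * det2 b d - det2 a d * det2 b c"
  by (simp add: det2_eq algebra_simps)

section \<open>Smooth functions\<close>

lemma velocity_eqI: "(f has_vector_derivative d) (at t) \<Longrightarrow> velocity f t = d"
  unfolding velocity_def by (rule vector_derivative_at)

lemma has_velocity:
  "f differentiable (at t) \<Longrightarrow> (f has_vector_derivative velocity f t) (at t)"
  unfolding velocity_def by (simp add: vector_derivative_works)

lemma has_vector_derivative_shift_iff:
  fixes f :: "real \<Rightarrow> 'a::real_normed_vector"
  shows "((\<lambda>t. f (t + c)) has_vector_derivative d) (at t) \<longleftrightarrow> (f has_vector_derivative d) (at (t + c))"
proof
  assume "(f has_vector_derivative d) (at (t + c))"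
  moreover have "((\<lambda>t. t + c) has_vector_derivative 1) (at t)"
    by (auto intro!: derivative_eq_intros)
  ultimately show "((\<lambda>t. f (t + c)) has_vector_derivative d) (at t)"
    using vector_diff_chain_at[of "\<lambda>t. t + c" 1 t f d] by (simp add: o_def)
next
  assume "((\<lambda>t. f (t + c)) has_vector_derivative d) (at t)"
  moreover have "((\<lambda>t. t - c) has_vector_derivative 1) (at (t + c))"
    by (auto intro!: derivative_eq_intros)
  ultimately show "(f has_vector_derivative d) (at (t + c))"
    using vector_diff_chain_at[of "\<lambda>t. t - c" 1 "t + c" "\<lambda>t. f (t + c)" d] by (simp add: o_def)
qed

lemma velocity_shift: "velocity (\<lambda>t. f (t + c)) = (\<lambda>t. velocity f (t + c))"
  unfolding velocity_def vector_derivative_def has_vector_derivative_shift_iff ..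

lemma nth_derivative_0 [simp]: "nth_derivative 0 f = f"
  by (simp add: nth_derivative_def)

lemma nth_derivative_Suc: "nth_derivative (Suc n) f = nth_derivative n (velocity f)"
  unfolding nth_derivative_def by (metis comp_apply funpow_Suc_right)

text \<open>Finite order with recursion through the first derivative. Leibniz rules produce sums of
  new products, so the induction must run over the order with the functions left general.\<close>

fun differentiable_upto :: "nat \<Rightarrow> (real \<Rightarrow> 'a::real_normed_vector) \<Rightarrow> bool" where
  "differentiable_upto 0 f \<longleftrightarrow> (\<forall>t. f differentiable (at t))"
| "differentiable_upto (Suc n) f \<longleftrightarrow>
     (\<forall>t. f differentiable (at t)) \<and> differentiable_upto n (velocity f)"

lemma differentiable_upto_iff:
  "differentiable_upto n f \<longleftrightarrow> (\<forall>j\<le>n. \<forall>t. nth_derivative j f differentiable (at t))"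
proof (induction n arbitrary: f)
  case (Suc n)
  have "(\<forall>j\<le>Suc n. P j) \<longleftrightarrow> P 0 \<and> (\<forall>j\<le>n. P (Suc j))" for P
    by (metis Suc_le_mono le0 not0_implies_Suc)
  then show ?case
    by (simp add: Suc nth_derivative_Suc)
qed simp

lemma smooth_iff_upto: "smooth f \<longleftrightarrow> (\<forall>n. differentiable_upto n f)"
  unfolding smooth_def differentiable_upto_iff by blast

lemma differentiable_upto_D: "differentiable_upto n f \<Longrightarrow> f differentiable (at t)"
  by (cases n) auto

lemma differentiable_upto_antimono: "differentiable_upto (Suc n) f \<Longrightarrow> differentiable_upto n f"
  by (simp add: differentiable_upto_iff)

lemma smooth_differentiable: "smooth f \<Longrightarrow> f differentiable (at t)"
  unfolding smooth_iff_upto using differentiable_upto_D by blast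

lemma smooth_velocity: "smooth f \<Longrightarrow> smooth (velocity f)"
  unfolding smooth_iff_upto by (metis differentiable_upto.simps(2))

lemma smooth_has_velocity: "smooth f \<Longrightarrow> (f has_vector_derivative velocity f t) (at t)"
  by (simp add: has_velocity smooth_differentiable)

lemma smoothI:
  assumes "\<And>t. (f has_vector_derivative g t) (at t)" "smooth g"
  shows "smooth f"
proof -
  have v: "velocity f = g" using assms(1) by (auto intro: velocity_eqI)
  have "differentiable_upto n f" for n
    using assms by (cases n) (auto simp: v smooth_iff_upto intro: differentiableI_vector)
  then show ?thesis by (simp add: smooth_iff_upto)
qed

lemma continuous_on_if_has_vector_derivative:
  assumes "\<And>t. (f has_vector_derivative g t) (at t)"
  shows "continuous_on S f"
  using assms by (intro continuous_at_imp_continuous_on) (auto intro: has_vector_derivative_continuous)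

lemma smooth_continuous: "smooth f \<Longrightarrow> continuous_on S f"
  by (rule continuous_on_if_has_vector_derivative) (rule smooth_has_velocity)

lemma differentiable_upto_add:
  "differentiable_upto n f \<Longrightarrow> differentiable_upto n g \<Longrightarrow> differentiable_upto n (\<lambda>t. f t + g t)"
proof (induction n arbitrary: f g)
  case (Suc n)
  then have "velocity (\<lambda>t. f t + g t) = (\<lambda>t. velocity f t + velocity g t)"
    by (auto intro!: velocity_eqI has_vector_derivative_add has_velocity)
  with Suc show ?case by simp
qed simp

lemma differentiable_upto_bilinear:
  assumes "bounded_bilinear h"
  shows "differentiable_upto n f \<Longrightarrow> differentiable_upto n g \<Longrightarrow>
    differentiable_upto n (\<lambda>t. h (f t) (g t))"
proof (induction n arbitrary: f g)
  case 0
  then have "((\<lambda>t. h (f t) (g t)) has_vector_derivative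
      h (f t) (velocity g t) + h (velocity f t) (g t)) (at t)" for t
    by (intro bounded_bilinear.has_vector_derivative[OF assms] has_velocity) auto
  then show ?case by (auto intro: differentiableI_vector)
next
  case (Suc n)
  then have *: "((\<lambda>t. h (f t) (g t)) has_vector_derivative
      h (f t) (velocity g t) + h (velocity f t) (g t)) (at t)" for t
    by (intro bounded_bilinear.has_vector_derivative[OF assms] has_velocity) auto
  then have "velocity (\<lambda>t. h (f t) (g t)) =
      (\<lambda>t. h (f t) (velocity g t) + h (velocity f t) (g t))"
    by (auto intro: velocity_eqI)
  moreover have "differentiable_upto n (\<lambda>t. h (f t) (velocity g t) + h (velocity f t) (g t))"
    using Suc.prems by (intro differentiable_upto_add Suc.IH) (auto intro: differentiable_upto_antimono)
  ultimately show ?case using * by (auto intro: differentiableI_vector)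
qed

lemma smooth_add: "smooth f \<Longrightarrow> smooth g \<Longrightarrow> smooth (\<lambda>t. f t + g t)"
  by (simp add: smooth_iff_upto differentiable_upto_add)

lemma smooth_bilinear:
  "bounded_bilinear h \<Longrightarrow> smooth f \<Longrightarrow> smooth g \<Longrightarrow> smooth (\<lambda>t. h (f t) (g t))"
  by (simp add: smooth_iff_upto differentiable_upto_bilinear)

lemmas smooth_mult = smooth_bilinear [OF bounded_bilinear_mult]
lemmas smooth_scaleR = smooth_bilinear [OF bounded_bilinear_scaleR]
lemmas smooth_det2 = smooth_bilinear [OF bounded_bilinear_det2]

lemma velocity_const [simp]: "velocity (\<lambda>t. c) = (\<lambda>t. 0)"
  by (auto intro!: velocity_eqI)

lemma smooth_const: "smooth (\<lambda>t. c)"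
proof -
  have "differentiable_upto n (\<lambda>t. c)" for n and c :: 'a
    by (induction n arbitrary: c) auto
  then show ?thesis by (simp add: smooth_iff_upto)
qed

lemma smooth_uminus: "smooth f \<Longrightarrow> smooth (\<lambda>t. - f t)"
  using smooth_scaleR[OF smooth_const[of "-1"]] by simp

lemma smooth_shift:
  fixes f :: "real \<Rightarrow> 'a::real_normed_vector"
  shows "smooth f \<Longrightarrow> smooth (\<lambda>t. f (t + c))"
proof -
  have shift: "(\<lambda>t. g (t + c)) differentiable (at t)" if "\<forall>t. g differentiable (at t)"
    for g :: "real \<Rightarrow> 'a" and t
    using that has_velocity[of g "t + c"] has_vector_derivative_shift_iff
    by (blast intro: differentiableI_vector)
  have "differentiable_upto n f \<Longrightarrow> differentiable_upto n (\<lambda>t. f (t + c))" for n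
  proof (induction n arbitrary: f)
    case 0
    then show ?case by (simp add: shift)
  next
    case (Suc n)
    then show ?case by (simp add: shift velocity_shift)
  qed
  then show "smooth f \<Longrightarrow> ?thesis" by (simp add: smooth_iff_upto)
qed

text \<open>The derivative of \<open>1 / f\<close> is a product of \<open>- f'\<close> with two
  copies of \<open>1 / f\<close> itself, so differentiability of order \<open>n\<close> reproduces
  itself at order \<open>n + 1\<close>.\<close>

lemma smooth_inverse:
  fixes f :: "real \<Rightarrow> real"
  assumes "smooth f" "\<And>t. f t \<noteq> 0"
  shows "smooth (\<lambda>t. inverse (f t))"
proof -
  have d: "((\<lambda>t. inverse (f t)) has_vector_derivative
      - velocity f t * (inverse (f t) * inverse (f t))) (at t)" for t
    using smooth_has_velocity[OF assms(1), of t] assms(2)[of t]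
    unfolding has_real_derivative_iff_has_vector_derivative [symmetric]
    by (auto intro!: derivative_eq_intros)
  have "differentiable_upto n (\<lambda>t. inverse (f t))" for n
  proof (induction n)
    case 0
    show ?case using d by (auto intro: differentiableI_vector)
  next
    case (Suc n)
    have "velocity (\<lambda>t. inverse (f t)) = (\<lambda>t. - velocity f t * (inverse (f t) * inverse (f t)))"
      using velocity_eqI[OF d] by blast
    moreover have "differentiable_upto n (\<lambda>t. - velocity f t)"
      using smooth_uminus[OF smooth_velocity[OF assms(1)]] by (simp add: smooth_iff_upto)
    then have "differentiable_upto n (\<lambda>t. - velocity f t * (inverse (f t) * inverse (f t)))"
      using Suc by (intro differentiable_upto_bilinear[OF bounded_bilinear_mult])
    ultimately show ?case
      using differentiableI_vector[OF d] by simp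
  qed
  then show ?thesis by (simp add: smooth_iff_upto)
qed

section \<open>Sequences tending to zero with all derivatives\<close>

fun null_upto :: "nat \<Rightarrow> (nat \<Rightarrow> real \<Rightarrow> 'a::real_normed_vector) \<Rightarrow> bool" where
  "null_upto 0 F \<longleftrightarrow> uniform_limit UNIV F (\<lambda>_. 0) sequentially"
| "null_upto (Suc n) F \<longleftrightarrow> uniform_limit UNIV F (\<lambda>_. 0) sequentially \<and>
     null_upto n (\<lambda>i. velocity (F i))"

lemma null_upto_iff:
  "null_upto n F \<longleftrightarrow> (\<forall>j\<le>n. uniform_limit UNIV (\<lambda>i. nth_derivative j (F i)) (\<lambda>_. 0) sequentially)"
proof (induction n arbitrary: F)
  case (Suc n)
  have "(\<forall>j\<le>Suc n. P j) \<longleftrightarrow> P 0 \<and> (\<forall>j\<le>n. P (Suc j))" for P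
    by (metis Suc_le_mono le0 not0_implies_Suc)
  then show ?case
    by (simp add: Suc nth_derivative_Suc)
qed simp

lemma null_upto_imp_uniform_limit: "null_upto n F \<Longrightarrow> uniform_limit UNIV F (\<lambda>_. 0) sequentially"
  by (cases n) auto

lemma null_upto_antimono: "null_upto (Suc n) F \<Longrightarrow> null_upto n F"
  by (simp add: null_upto_iff)

lemma null_upto_add:
  assumes "\<And>i. smooth (F i)" "\<And>i. smooth (G i)" "null_upto n F" "null_upto n G"
  shows "null_upto n (\<lambda>i t. F i t + G i t)"
  using assms
proof (induction n arbitrary: F G)
  case 0
  then show ?case
    using uniform_limit_add[OF null_upto_imp_uniform_limit null_upto_imp_uniform_limit, of 0 F 0 G] by simp
next
  case (Suc n)
  have "velocity (\<lambda>t. F i t + G i t) = (\<lambda>t. velocity (F i) t + velocity (G i) t)" for i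
    by (intro ext velocity_eqI has_vector_derivative_add smooth_has_velocity Suc.prems)
  moreover have "null_upto n (\<lambda>i t. velocity (F i) t + velocity (G i) t)"
    using Suc.prems by (intro Suc.IH smooth_velocity) auto
  moreover have "uniform_limit UNIV (\<lambda>i t. F i t + G i t) (\<lambda>_. 0) sequentially"
    using uniform_limit_add[OF null_upto_imp_uniform_limit null_upto_imp_uniform_limit,
        OF Suc.prems(3,4)] by simp
  ultimately show ?case by simp
qed

section \<open>Periodic functions and uniform bounds\<close>

definition has_period :: "real \<Rightarrow> (real \<Rightarrow> 'a) \<Rightarrow> bool" where
  "has_period T f \<longleftrightarrow> (\<forall>t. f (t + T) = f t)"

lemma has_period_velocity:
  assumes "has_period T f"
  shows "has_period T (velocity f)"
proof -
  have "(\<lambda>t. f (t + T)) = f"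
    using assms by (auto simp: has_period_def)
  then show ?thesis
    using velocity_shift[of f T] unfolding has_period_def by (simp add: fun_eq_iff)
qed

lemma has_period_nat: "has_period T f \<Longrightarrow> f (t + of_nat n * T) = f t"
proof (induction n)
  case (Suc n)
  then show ?case
    unfolding has_period_def by (metis add.commute add.assoc of_nat_Suc distrib_right mult_1)
qed simp

lemma has_period_int:
  assumes "has_period T f"
  shows "f (t + of_int k * T) = f t"
proof (cases k)
  case (nonneg n)
  then show ?thesis using has_period_nat[OF assms] by auto
next
  case (neg n)
  then have *: "t + of_int k * T + of_nat (Suc n) * T = t"
    by (simp add: distrib_right [symmetric] add.assoc del: distrib_right_numeral)
  show ?thesis
    by (rule has_period_nat[OF assms, of "t + of_int k * T" "Suc n", unfolded *, symmetric])
qed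

text \<open>One \<open>s\<close> serves for all \<open>r\<close>, so whole arcs of the graph are
  moved into a single period and not only values.\<close>

lemma has_period_reduce:
  assumes "has_period T f" "T > 0"
  obtains s where "0 \<le> s" "s < T" "\<And>r. f (t + r) = f (s + r)"
proof
  define k where "k = \<lfloor>t / T\<rfloor>"
  show "0 \<le> t - of_int k * T" "t - of_int k * T < T"
    using assms(2) floor_divide_lower[of T t] floor_divide_upper[of T t]
    by (auto simp: k_def algebra_simps)
  show "f (t + r) = f (t - of_int k * T + r)" for r
    using has_period_int[OF assms(1), of "t - of_int k * T + r" k] by (simp add: algebra_simps)
qed

lemma has_period_bounded:
  assumes "has_period T f" "T > 0" "continuous_on UNIV f"
  obtains B where "B > 0" "\<And>t. norm (f t) \<le> B"
proof -
  have "bounded (f ` {0..T})"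
    by (intro compact_imp_bounded compact_continuous_image continuous_on_subset[OF assms(3)]) auto
  then obtain B where B: "B > 0" "\<And>t. t \<in> {0..T} \<Longrightarrow> norm (f t) \<le> B"
    unfolding bounded_pos by auto
  show thesis
  proof
    show "norm (f t) \<le> B" for t
      using has_period_reduce[OF assms(1,2), of t] B(2)
      by (metis add.right_neutral atLeastAtMost_iff less_imp_le)
  qed fact
qed

lemma uniform_limit_bilinear_bounded:
  fixes c :: "real \<Rightarrow> 'a::real_normed_vector" and F :: "nat \<Rightarrow> real \<Rightarrow> 'b::real_normed_vector"
  assumes "bounded_bilinear h" "uniform_limit UNIV F (\<lambda>_. 0) sequentially" "\<And>t. norm (c t) \<le> B"
  shows "uniform_limit UNIV (\<lambda>i t. h (c t) (F i t)) (\<lambda>_. 0) sequentially"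
proof -
  interpret bounded_bilinear h by fact
  have "bounded (range c)" "bounded (range (\<lambda>_::real. 0 :: 'b))"
    using assms(3) unfolding bounded_iff by auto
  then have "uniform_limit UNIV (\<lambda>i t. h (c t) (F i t)) (\<lambda>t. h (c t) 0) sequentially"
    using assms(2) by (intro bounded_uniform_limit uniform_limit_const) auto
  then show ?thesis by (simp add: zero_right)
qed

text \<open>Periodicity bounds \<open>c\<close> and, in the induction, each of its derivatives; this
  is what lets every term of the Leibniz rule tend to zero uniformly on the whole line.\<close>

lemma null_upto_bilinear:
  assumes h: "bounded_bilinear h" and "T > 0"
    and "smooth c" "has_period T c" "\<And>i. smooth (F i)" "null_upto n F"
  shows "null_upto n (\<lambda>i t. h (c t) (F i t))"
  using assms(3-)
proof (induction n arbitrary: c F)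
  case 0
  obtain B where "\<And>t. norm (c t) \<le> B"
    using has_period_bounded[OF 0(2) \<open>T > 0\<close> smooth_continuous[OF 0(1)]] by blast
  from uniform_limit_bilinear_bounded[OF h _ this] 0 show ?case by simp
next
  case (Suc n)
  obtain B where "\<And>t. norm (c t) \<le> B"
    using has_period_bounded[OF Suc.prems(2) \<open>T > 0\<close> smooth_continuous[OF Suc.prems(1)]] by blast
  from uniform_limit_bilinear_bounded[OF h _ this]
  have "uniform_limit UNIV (\<lambda>i t. h (c t) (F i t)) (\<lambda>_. 0) sequentially"
    using Suc.prems by simp
  moreover have "velocity (\<lambda>t. h (c t) (F i t)) =
      (\<lambda>t. h (c t) (velocity (F i) t) + h (velocity c t) (F i t))" for i
    by (intro ext velocity_eqI bounded_bilinear.has_vector_derivative[OF h] smooth_has_velocity Suc.prems)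
  moreover have "null_upto n (\<lambda>i t. h (c t) (velocity (F i) t) + h (velocity c t) (F i t))"
    using Suc.prems
    by (intro null_upto_add Suc.IH smooth_bilinear[OF h] smooth_velocity has_period_velocity)
       (auto intro: null_upto_antimono simp del: null_upto.simps simp: null_upto.simps(2))
  ultimately show ?case by simp
qed

lemma Cinf_converges_const:
  assumes "\<And>i. smooth (F i)" "uniform_limit UNIV F (\<lambda>_. p) sequentially"
    "\<And>n. null_upto n (\<lambda>i. velocity (F i))"
  shows "Cinf_converges F (\<lambda>_. p)"
proof -
  have z: "nth_derivative n (\<lambda>_. 0) = (\<lambda>_::real. 0::'a)" for n
    by (induction n) (auto simp: nth_derivative_Suc)
  have "uniform_limit UNIV (\<lambda>i. nth_derivative n (F i)) (nth_derivative n (\<lambda>_. p)) sequentially" for n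
  proof (cases n)
    case (Suc m)
    then show ?thesis
      using assms(3)[of m] by (simp add: nth_derivative_Suc z null_upto_iff)
  qed (use assms in simp)
  then show ?thesis
    unfolding Cinf_converges_def using assms(1) by (auto intro: smooth_const)
qed

section \<open>Integrals over half periods\<close>

text \<open>An antiderivative on the whole line allows integrals with two moving end points to be
  treated as differences \<open>F (t + pi) - F t\<close>.\<close>

lemma antiderivative_exists:
  fixes f :: "real \<Rightarrow> 'a::euclidean_space"
  assumes "continuous_on UNIV f"
  obtains F where "\<And>t. (F has_vector_derivative f t) (at t)"
    "\<And>a b. a \<le> b \<Longrightarrow> integral {a..b} f = F b - F a"
proof -
  have "\<exists>F. \<forall>x::real. -\<infinity> < ereal x \<longrightarrow> ereal x < \<infinity> \<longrightarrow> (F has_vector_derivative f x) (at x)"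
    using assms by (intro einterval_antiderivative) (auto simp: continuous_on_eq_continuous_at)
  then obtain F where F: "\<And>t. (F has_vector_derivative f t) (at t)" by auto
  show thesis
  proof
    show "integral {a..b} f = F b - F a" if "a \<le> b" for a b
      using F that by (intro integral_unique fundamental_theorem_of_calculus)
        (auto intro: has_vector_derivative_at_within)
  qed fact
qed

lemma integral_half_period_has_vector_derivative:
  fixes f :: "real \<Rightarrow> 'a::euclidean_space"
  assumes "continuous_on UNIV f"
  shows "((\<lambda>t. integral {t..t + pi} f) has_vector_derivative f (t + pi) - f t) (at t)"
proof -
  obtain F where F: "\<And>t. (F has_vector_derivative f t) (at t)"
      "\<And>a b. a \<le> b \<Longrightarrow> integral {a..b} f = F b - F a"
    using antiderivative_exists[OF assms] by blast
  have "(\<lambda>t. integral {t..t + pi} f) = (\<lambda>t. F (t + pi) - F t)"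
    using F(2) pi_ge_zero by auto
  then show ?thesis
    using F(1) by (auto intro!: has_vector_derivative_diff simp: has_vector_derivative_shift_iff)
qed

lemma integral_period_shift:
  fixes f :: "real \<Rightarrow> 'a::euclidean_space"
  assumes "continuous_on UNIV f" "has_period pi f"
  shows "integral {a..a + pi} f = integral {0..pi} f"
proof -
  have "((\<lambda>t. integral {t..t + pi} f) has_derivative (\<lambda>h. 0)) (at t)" for t
    using integral_half_period_has_vector_derivative[OF assms(1), of t] assms(2)
    by (simp add: has_vector_derivative_def has_period_def)
  then have "\<exists>c. \<forall>t\<in>UNIV. integral {t..t + pi} f = c"
    by (intro has_derivative_zero_constant) auto
  then show ?thesis by (metis UNIV_I add_0)
qed

text \<open>The sum \<open>F (t + pi) + F t\<close> has derivative zero, hence the antiderivative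
  \<open>F\<close> has period \<open>2 * pi\<close>.\<close>

lemma integral_antiperiodic:
  fixes f :: "real \<Rightarrow> 'a::euclidean_space"
  assumes "continuous_on UNIV f" "\<And>t. f (t + pi) = - f t"
  shows "integral {t + pi..t + pi + pi} f = - integral {t..t + pi} f"
proof -
  obtain F where F: "\<And>t. (F has_vector_derivative f t) (at t)"
      "\<And>a b. a \<le> b \<Longrightarrow> integral {a..b} f = F b - F a"
    using antiderivative_exists[OF assms(1)] by blast
  have "((\<lambda>t. F (t + pi) + F t) has_vector_derivative f (t + pi) + f t) (at t)" for t
    using F(1) by (auto intro!: has_vector_derivative_add simp: has_vector_derivative_shift_iff)
  then have "((\<lambda>t. F (t + pi) + F t) has_derivative (\<lambda>h. 0)) (at t)" for t
    using assms(2) by (simp add: has_vector_derivative_def)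
  then have "\<exists>c. \<forall>t\<in>UNIV. F (t + pi) + F t = c"
    by (intro has_derivative_zero_constant) auto
  then have "F (t + pi + pi) = F t"
    by (metis UNIV_I add.commute add_left_imp_eq)
  then show ?thesis
    using F(2)[of "t + pi" "t + pi + pi"] F(2)[of t "t + pi"]
    by simp
qed

lemma integral_mult_le_squares:
  fixes f q :: "real \<Rightarrow> real"
  assumes "continuous_on {a..b} f" "continuous_on {a..b} q" "\<And>t. t \<in> {a..b} \<Longrightarrow> q t \<ge> 0"
    and pos: "integral {a..b} q > 0"
  shows "(integral {a..b} (\<lambda>t. q t * f t))\<^sup>2 \<le>
    integral {a..b} q * integral {a..b} (\<lambda>t. q t * (f t)\<^sup>2)"
proof -
  define W where "W = integral {a..b} q"
  define m where "m = integral {a..b} (\<lambda>t. q t * f t)"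
  define E where "E = integral {a..b} (\<lambda>t. q t * (f t)\<^sup>2)"
  have i: "(q has_integral W) {a..b}" "((\<lambda>t. q t * f t) has_integral m) {a..b}"
    "((\<lambda>t. q t * (f t)\<^sup>2) has_integral E) {a..b}"
    unfolding W_def m_def E_def
    by (intro integrable_integral integrable_continuous_real continuous_intros assms)+
  \<comment> \<open>Expansion of \<open>q * (W * f - m)\<^sup>2\<close>, the deviation of
    \<open>f\<close> from its weighted mean \<open>m / W\<close> with the denominator
    cleared.\<close>
  have "((\<lambda>t. W\<^sup>2 * (q t * (f t)\<^sup>2) - 2 * W * m * (q t * f t) + m\<^sup>2 * q t) has_integral
      W\<^sup>2 * E - 2 * W * m * m + m\<^sup>2 * W) {a..b}"
    by (intro has_integral_add has_integral_diff has_integral_mult_right i)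
  then have "((\<lambda>t. q t * (W * f t - m)\<^sup>2) has_integral W * (W * E - m\<^sup>2)) {a..b}"
    by (rule back_subst[of "\<lambda>I. (_ has_integral I) _", OF has_integral_eq[rotated]])
      (auto simp: power2_eq_square algebra_simps)
  then have "0 \<le> W * (W * E - m\<^sup>2)"
    by (rule has_integral_nonneg) (use assms(3) in auto)
  then show ?thesis
    using pos unfolding W_def [symmetric] m_def [symmetric] E_def [symmetric]
    by (simp add: zero_le_mult_iff)
qed

section \<open>Dual pairs of symmetric curves\<close>

lemma tendsto_quotient_at_common_zero:
  fixes f g :: "real \<Rightarrow> real"
  assumes "(f has_real_derivative f') (at c)" "(g has_real_derivative g') (at c)"
    "f c = 0" "g c = 0" "g' \<noteq> 0"
  shows "((\<lambda>x. f x / g x) \<longlongrightarrow> f' / g') (at c)"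
proof -
  have "((\<lambda>x. (f x / (x - c)) / (g x / (x - c))) \<longlongrightarrow> f' / g') (at c)"
    using assms unfolding has_field_derivative_iff by (intro tendsto_divide) auto
  moreover have "\<forall>\<^sub>F x in at c. (f x / (x - c)) / (g x / (x - c)) = f x / g x"
    by (auto simp: eventually_at intro!: exI[of _ 1])
  ultimately show ?thesis
    using tendsto_cong by fast
qed

text \<open>The assumptions are closed under the exchange of \<open>(u, v, w, z)\<close> for
  \<open>(v, - u, z, w)\<close>, so each result about curves with tangent direction \<open>v\<close>
  is also available for tangent direction \<open>u\<close>. The last two conditions express
  convexity of both curves.\<close>

locale dual_pair =
  fixes u v :: "real \<Rightarrow> real ^ 2" and w z :: "real \<Rightarrow> real"
  assumes u_deriv: "(u has_vector_derivative w t *\<^sub>R v t) (at t)"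
    and v_deriv: "(v has_vector_derivative - (z t *\<^sub>R u t)) (at t)"
    and w_cont: "continuous_on UNIV w" and z_cont: "continuous_on UNIV z"
    and w_pos: "w t > 0" and z_pos: "z t > 0"
    and w_periodic: "w (t + pi) = w t" and z_periodic: "z (t + pi) = z t"
    and u_anti: "u (t + pi) = - u t" and v_anti: "v (t + pi) = - v t"
    and det_uv: "det2 (u t) (v t) = 1"
    and det_uu_pos: "a < b \<Longrightarrow> b < a + pi \<Longrightarrow> det2 (u a) (u b) > 0"
    and det_vv_pos: "a < b \<Longrightarrow> b < a + pi \<Longrightarrow> det2 (v a) (v b) > 0"
begin

lemma dual: "dual_pair v (\<lambda>t. - u t) z w"
proof
  fix t
  show "((\<lambda>t. - u t) has_vector_derivative - (w t *\<^sub>R v t)) (at t)"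
    by (rule has_vector_derivative_minus) (rule u_deriv)
  show "(v has_vector_derivative z t *\<^sub>R - u t) (at t)"
    using v_deriv by simp
  show "det2 (v t) (- u t) = 1"
    using det_uv[of t] det2_swap[of "v t" "u t"] by simp
qed (auto simp: w_cont z_cont w_pos z_pos w_periodic z_periodic u_anti v_anti det_uu_pos det_vv_pos)

lemma u_cont: "continuous_on S u"
  using u_deriv by (rule continuous_on_if_has_vector_derivative)

lemma v_cont: "continuous_on S v"
  using v_deriv by (rule continuous_on_if_has_vector_derivative)

lemma det_left_u_deriv: "((\<lambda>x. det2 a (u x)) has_real_derivative w t * det2 a (v t)) (at t)"
  unfolding has_real_derivative_iff_has_vector_derivative
  using det2_has_vector_derivative[OF has_vector_derivative_const u_deriv, of a t] by simp

lemma det_left_v_deriv: "((\<lambda>x. det2 a (v x)) has_real_derivative - (z t * det2 a (u t))) (at t)"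
  unfolding has_real_derivative_iff_has_vector_derivative
  using det2_has_vector_derivative[OF has_vector_derivative_const v_deriv, of a t] by simp

text \<open>The sign changes of \<open>y\<close> and \<open>v\<close> cancel, so the integrand has
  period \<open>pi\<close> and the half period may start anywhere; pairing with \<open>a\<close>
  gives orthogonality to the eigenfunction \<open>[a, v]\<close>.\<close>

lemma orthogonal_v_component:
  fixes y :: "real \<Rightarrow> real"
  assumes cont: "continuous_on UNIV y" and "\<And>t. y (t + pi) = - y t"
    and orth: "integral {0..pi} (\<lambda>t. (w t * y t) *\<^sub>R v t) = 0"
  shows "((\<lambda>t. w t * (y t * det2 a (v t))) has_integral 0) {c..c + pi}"
proof -
  have i: "continuous_on UNIV (\<lambda>t. (w t * y t) *\<^sub>R v t)"
    by (intro continuous_intros cont w_cont v_cont)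
  have "integral {c..c + pi} (\<lambda>t. (w t * y t) *\<^sub>R v t) = integral {0..pi} (\<lambda>t. (w t * y t) *\<^sub>R v t)"
    by (rule integral_period_shift[OF i]) (simp add: has_period_def w_periodic assms(2) v_anti)
  moreover have "(\<lambda>t. (w t * y t) *\<^sub>R v t) integrable_on {c..c + pi}"
    by (intro integrable_continuous_real continuous_on_subset[OF i]) auto
  ultimately have "((\<lambda>t. (w t * y t) *\<^sub>R v t) has_integral 0) {c..c + pi}"
    using orth by (simp add: has_integral_iff)
  from has_integral_linear[OF this bounded_bilinear.bounded_linear_right[OF bounded_bilinear_det2, of a]]
  show ?thesis by (simp add: o_def mult.assoc)
qed

text \<open>
  Picone's identity: with \<open>\<eta> = [v c, v]\<close> and \<open>\<zeta> = - [v c, u]\<close>, the integrand of the energy exceeds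
  the derivative of \<open>y\<^sup>2 \<zeta> / \<eta>\<close> by \<open>\<eta>\<^sup>2 (y / \<eta>)'\<^sup>2 / z\<close>. Since \<open>z / \<eta>\<^sup>2\<close> is the derivative of
  \<open>- [u c, v] / \<eta>\<close>, the Cauchy--Schwarz inequality turns this into a pointwise bound on the
  increments of \<open>y / \<eta>\<close>. It is stated without quotients so that it extends to the end points, where
  \<open>y\<close> and \<open>\<eta>\<close> both vanish.
\<close>

lemma picone_bound:
  fixes y b :: "real \<Rightarrow> real"
  assumes y_deriv: "\<And>t. (y has_real_derivative z t * b t) (at t)"
    and \<Phi>: "\<And>t. (\<Phi> has_real_derivative z t * (b t)\<^sup>2 - w t * (y t)\<^sup>2) (at t)"
    and y0: "y c = 0" "y (c + pi) = 0"
  shows "\<Phi> c \<le> \<Phi> (c + pi)"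
    and "c < s \<Longrightarrow> s < t \<Longrightarrow> t < c + pi \<Longrightarrow>
      (y t * det2 (v c) (v s) - y s * det2 (v c) (v t))\<^sup>2
        \<le> (\<Phi> (c + pi) - \<Phi> c) * (det2 (v c) (v s) * det2 (v c) (v t) * det2 (v s) (v t))"
proof -
  define \<eta> where "\<eta> x = det2 (v c) (v x)" for x
  define \<zeta> where "\<zeta> x = - det2 (v c) (u x)" for x
  \<comment> \<open>The second eigenfunction, whose Wronskian with \<eta> is 1; this makes
    \<open>- \<xi> / \<eta>\<close> a primitive of \<open>z / \<eta>\<^sup>2\<close>.\<close>
  define \<xi> where "\<xi> x = det2 (u c) (v x)" for x
  \<comment> \<open>The Wronskian of \<open>y\<close> and \<eta>: it vanishes identically when
    \<open>y\<close> is a multiple of \<eta>, and both \<open>f'\<close> and \<open>F'\<close> are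
    expressed by it.\<close>
  define g where "g x = b x * \<eta> x - y x * \<zeta> x" for x
  define F where "F x = \<Phi> x - (y x)\<^sup>2 * \<zeta> x / \<eta> x" for x
  define f where "f x = y x / \<eta> x" for x
  define G where "G x = - \<xi> x / \<eta> x" for x
  have \<eta>_deriv: "(\<eta> has_real_derivative z x * \<zeta> x) (at x)" for x
    using det_left_v_deriv[of "v c" x] unfolding \<eta>_def \<zeta>_def by simp
  have \<zeta>_deriv: "(\<zeta> has_real_derivative - (w x * \<eta> x)) (at x)" for x
    using DERIV_minus[OF det_left_u_deriv[of "v c" x]] unfolding \<eta>_def \<zeta>_def by simp
  have \<xi>_deriv: "(\<xi> has_real_derivative - (z x * det2 (u c) (u x))) (at x)" for x
    using det_left_v_deriv unfolding \<xi>_def by simp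
  have \<eta>_pos: "\<eta> x > 0" if "c < x" "x < c + pi" for x
    using det_vv_pos that unfolding \<eta>_def by blast
  have F_deriv: "(F has_real_derivative z x * (g x)\<^sup>2 / (\<eta> x)\<^sup>2) (at x)" if "c < x" "x < c + pi" for x
    unfolding F_def g_def
    by (rule DERIV_cong[OF DERIV_diff[OF \<Phi> DERIV_divide[OF DERIV_mult[OF DERIV_power[OF y_deriv] \<zeta>_deriv] \<eta>_deriv]]])
       (use \<eta>_pos[OF that] in \<open>simp_all add: field_simps power2_eq_square\<close>)
  have f_deriv: "(f has_real_derivative z x * g x / (\<eta> x)\<^sup>2) (at x)" if "c < x" "x < c + pi" for x
    unfolding f_def g_def
    by (rule DERIV_cong[OF DERIV_divide[OF y_deriv \<eta>_deriv]])
       (use \<eta>_pos[OF that] in \<open>simp_all add: field_simps power2_eq_square\<close>)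
  have G_deriv: "(G has_real_derivative z x / (\<eta> x)\<^sup>2) (at x)" if "c < x" "x < c + pi" for x
  proof -
    have *: "det2 (u c) (u x) * \<eta> x + \<xi> x * \<zeta> x = 1"
      using det2_pluecker[of "u c" "v c" "u x" "v x"] det_uv by (simp add: \<eta>_def \<xi>_def \<zeta>_def)
    have "(G has_real_derivative z x * (det2 (u c) (u x) * \<eta> x + \<xi> x * \<zeta> x) / (\<eta> x)\<^sup>2) (at x)"
      unfolding G_def
      by (rule DERIV_cong[OF DERIV_divide[OF DERIV_minus[OF \<xi>_deriv] \<eta>_deriv]])
         (use \<eta>_pos[OF that] in \<open>simp_all add: field_simps power2_eq_square\<close>)
    then show ?thesis unfolding * by simp
  qed
  \<comment> \<open>At the end points division by zero makes \<open>F\<close> equal to \<Phi>, which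
    is the right limit: \<open>y / \<eta>\<close> stays finite because \<eta> has a simple zero, and
    the remaining factor \<open>y * \<zeta>\<close> tends to 0.\<close>
  have F_isCont_end: "isCont F x" if "\<eta> x = 0" "y x = 0" "\<zeta> x \<noteq> 0" for x
  proof -
    have "((\<lambda>s. y s / \<eta> s) \<longlongrightarrow> z x * b x / (z x * \<zeta> x)) (at x)"
      using that z_pos[of x] by (intro tendsto_quotient_at_common_zero[OF y_deriv \<eta>_deriv]) auto
    moreover have "(\<zeta> \<longlongrightarrow> \<zeta> x) (at x)" "(y \<longlongrightarrow> y x) (at x)"
      using DERIV_isCont[OF \<zeta>_deriv] DERIV_isCont[OF y_deriv] by (auto simp: isCont_def)
    ultimately have "((\<lambda>s. y s * \<zeta> s * (y s / \<eta> s)) \<longlongrightarrow> y x * \<zeta> x * (z x * b x / (z x * \<zeta> x))) (at x)"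
      by (intro tendsto_mult)
    then have "((\<lambda>s. (y s)\<^sup>2 * \<zeta> s / \<eta> s) \<longlongrightarrow> 0) (at x)"
      using that by (simp add: power2_eq_square mult_ac)
    then have "isCont (\<lambda>s. (y s)\<^sup>2 * \<zeta> s / \<eta> s) x"
      using that by (simp add: isCont_def)
    then show ?thesis
      unfolding F_def using DERIV_isCont[OF \<Phi>] by (intro isCont_diff) auto
  qed
  have \<eta>0: "\<eta> c = 0" "\<eta> (c + pi) = 0" "\<zeta> c \<noteq> 0" "\<zeta> (c + pi) \<noteq> 0"
    using det_uv[of c] det2_swap[of "v c" "u c"] by (auto simp: \<eta>_def \<zeta>_def v_anti u_anti)
  have "isCont F x" if x: "c \<le> x" "x \<le> c + pi" for x
  proof -
    consider "x = c" | "x = c + pi" | "c < x" "x < c + pi"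
      using x by fastforce
    then show ?thesis
    proof cases
      case 3
      then show ?thesis by (rule DERIV_isCont[OF F_deriv])
    qed (use F_isCont_end \<eta>0 y0 in blast)+
  qed
  then have F_cont: "continuous_on {c..c + pi} F"
    by (auto intro: continuous_at_imp_continuous_on)
  have F_mono: "F p \<le> F q" if "c \<le> p" "p \<le> q" "q \<le> c + pi" for p q
  proof (rule DERIV_nonneg_imp_increasing_open[OF \<open>p \<le> q\<close>])
    show "\<exists>d. (F has_real_derivative d) (at x) \<and> 0 \<le> d" if "p < x" "x < q" for x
      using F_deriv[of x] that \<open>c \<le> p\<close> \<open>q \<le> c + pi\<close> z_pos[of x]
      by (intro exI[of _ "z x * (g x)\<^sup>2 / (\<eta> x)\<^sup>2"]) auto
    show "continuous_on {p..q} F"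
      using that by (intro continuous_on_subset[OF F_cont]) auto
  qed
  have F_end: "F c = \<Phi> c" "F (c + pi) = \<Phi> (c + pi)"
    by (simp_all add: F_def y0)
  show "\<Phi> c \<le> \<Phi> (c + pi)"
    using F_mono[of c "c + pi"] F_end by simp
  assume st: "c < s" "s < t" "t < c + pi"
  define df where "df = f t - f s"
  define dG where "dG = G t - G s"
  \<comment> \<open>The derivative of this combination is
    \<open>z * (g - \<tau>)\<^sup>2 / \<eta>\<^sup>2\<close>. Monotonicity for every \<tau> is the
    Cauchy--Schwarz inequality for the increments of \<open>F\<close>, \<open>f\<close> and
    \<open>G\<close>, extracted below at the minimiser \<open>\<tau> = df / dG\<close>.\<close>
  have "F s - 2 * \<tau> * f s + \<tau>\<^sup>2 * G s \<le> F t - 2 * \<tau> * f t + \<tau>\<^sup>2 * G t" for \<tau>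
  proof (rule DERIV_nonneg_imp_nondecreasing[of s t "\<lambda>x. F x - 2 * \<tau> * f x + \<tau>\<^sup>2 * G x"])
    fix x assume "s \<le> x" "x \<le> t"
    then have x: "c < x" "x < c + pi" using st by auto
    have "((\<lambda>x. F x - 2 * \<tau> * f x + \<tau>\<^sup>2 * G x) has_real_derivative
        z x * (g x)\<^sup>2 / (\<eta> x)\<^sup>2 - 2 * \<tau> * (z x * g x / (\<eta> x)\<^sup>2) + \<tau>\<^sup>2 * (z x / (\<eta> x)\<^sup>2)) (at x)"
      by (intro DERIV_add DERIV_diff DERIV_cmult F_deriv f_deriv G_deriv x)
    also have "z x * (g x)\<^sup>2 / (\<eta> x)\<^sup>2 - 2 * \<tau> * (z x * g x / (\<eta> x)\<^sup>2) + \<tau>\<^sup>2 * (z x / (\<eta> x)\<^sup>2)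
        = z x * (g x - \<tau>)\<^sup>2 / (\<eta> x)\<^sup>2"
      using \<eta>_pos[OF x] by (simp add: field_simps power2_eq_square)
    finally show "\<exists>d. ((\<lambda>x. F x - 2 * \<tau> * f x + \<tau>\<^sup>2 * G x) has_real_derivative d) (at x) \<and> 0 \<le> d"
      using z_pos[of x] by (intro exI conjI) auto
  qed (use st in simp)
  then have quad: "0 \<le> (F t - F s) - 2 * \<tau> * df + \<tau>\<^sup>2 * dG" for \<tau>
    unfolding df_def dG_def by (simp add: algebra_simps)
  have pos: "\<eta> s > 0" "\<eta> t > 0" "det2 (v s) (v t) > 0"
    using \<eta>_pos st det_vv_pos by auto
  have "\<xi> s * \<eta> t - \<xi> t * \<eta> s = det2 (v s) (v t)"
    using det2_pluecker[of "u c" "v c" "v s" "v t"] det_uv by (simp add: \<eta>_def \<xi>_def)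
  then have dG_eq: "dG * (\<eta> s * \<eta> t) = det2 (v s) (v t)"
    using pos unfolding dG_def G_def by (simp add: field_simps)
  then have "dG > 0" using pos by (metis mult_pos_pos zero_less_mult_pos2)
  have "df\<^sup>2 \<le> (F t - F s) * dG"
    using quad[of "df / dG"] \<open>dG > 0\<close> by (simp add: field_simps power2_eq_square)
  also have "\<dots> \<le> (\<Phi> (c + pi) - \<Phi> c) * dG"
    using F_mono[of c s] F_mono[of t "c + pi"] F_end st \<open>dG > 0\<close> by (intro mult_right_mono) auto
  finally have "df\<^sup>2 * (\<eta> s * \<eta> t)\<^sup>2 \<le> (\<Phi> (c + pi) - \<Phi> c) * dG * (\<eta> s * \<eta> t)\<^sup>2"
    by (rule mult_right_mono) simp
  also have "\<dots> = (\<Phi> (c + pi) - \<Phi> c) * (\<eta> s * \<eta> t * (dG * (\<eta> s * \<eta> t)))"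
    by (simp add: power2_eq_square)
  also have "\<dots> = (\<Phi> (c + pi) - \<Phi> c) * (\<eta> s * \<eta> t * det2 (v s) (v t))"
    by (simp only: dG_eq)
  also have "df\<^sup>2 * (\<eta> s * \<eta> t)\<^sup>2 = (y t * \<eta> s - y s * \<eta> t)\<^sup>2"
    using pos unfolding df_def f_def by (simp add: field_simps flip: power_mult_distrib)
  finally show "(y t * det2 (v c) (v s) - y s * det2 (v c) (v t))\<^sup>2
      \<le> (\<Phi> (c + pi) - \<Phi> c) * (det2 (v c) (v s) * det2 (v c) (v t) * det2 (v s) (v t))"
    unfolding \<eta>_def .
qed

section \<open>Uniform constants and the spectral gap\<close>

lemma v_bounded: obtains B where "B > 0" "\<And>s t. \<bar>det2 (v s) (v t)\<bar> \<le> B"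
proof -
  have "has_period (2 * pi) v"
    unfolding has_period_def using v_anti by (metis add.assoc minus_minus mult_2)
  then obtain C where C: "C > 0" "\<And>t. norm (v t) \<le> C"
    using has_period_bounded[of "2 * pi" v] v_cont by auto
  have "\<bar>det2 (v s) (v t)\<bar> \<le> 2 * C * C" for s t
    using abs_det2_le[of "v s" "v t"] C
    by (smt (verit) mult_mono norm_ge_zero)
  then show thesis using C by (intro that[of "2 * C * C"]) auto
qed

text \<open>Compactness makes the bound uniform in \<open>c\<close>, which is essential because the
  zero used as \<open>c\<close> depends on the function \<open>y\<close>.\<close>

lemma det_vv_quarter_bound: obtains m where "m > 0" "\<And>c. c \<in> {0..pi} \<Longrightarrow> det2 (v c) (v (c + pi / 2)) \<ge> m"
proof -
  have "continuous_on {0..pi} (\<lambda>c. det2 (v c) (v (c + pi / 2)))"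
    by (intro continuous_intros v_cont continuous_on_compose2[OF v_cont[of UNIV]]) auto
  then obtain c where "\<forall>x\<in>{0..pi}. det2 (v c) (v (c + pi / 2)) \<le> det2 (v x) (v (x + pi / 2))"
    using continuous_attains_inf[of "{0..pi}" "\<lambda>c. det2 (v c) (v (c + pi / 2))"] by auto
  then show thesis
    using det_vv_pos[of c "c + pi / 2"] by (intro that[of "det2 (v c) (v (c + pi / 2))"]) auto
qed

lemma W_pos: "integral {a..a + pi} w > 0"
proof -
  have "integral {a..a+pi} w \<noteq> 0"
  proof
    assume "integral {a..a+pi} w = 0"
    then have "\<forall>x\<in>{a..a+pi}. w x = 0"
      using w_pos by (subst (asm) integral_eq_0_iff)
        (auto intro: continuous_on_subset[OF w_cont] less_imp_le)
    then show False using w_pos[of a] by auto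
  qed
  moreover have "integral {a..a+pi} w \<ge> 0"
    using w_pos by (intro integral_nonneg integrable_continuous_real continuous_on_subset[OF w_cont])
      (auto intro: less_imp_le)
  ultimately show ?thesis by simp
qed

definition energy :: "(real \<Rightarrow> real) \<Rightarrow> real" where
  "energy y = integral {0..pi} (\<lambda>t. w t * (y t)\<^sup>2)"

text \<open>When \<open>y' = z * b\<close>, this is the Dirichlet integral of
  \<open>y'\<^sup>2 / z\<close>, the numerator of the Rayleigh quotient with denominator
  \<open>energy y\<close>.\<close>

definition dual_energy :: "(real \<Rightarrow> real) \<Rightarrow> real" where
  "dual_energy b = integral {0..pi} (\<lambda>t. z t * (b t)\<^sup>2)"

text \<open>
  The components of \<open>v\<close> are the first eigenfunctions of the antiperiodic problem
  \<open>(y' / z)' + \<lambda> w y = 0\<close>, with eigenvalue 1; this is a quantitative form of the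
  statement that the remaining eigenvalues exceed 1.
\<close>

lemma spectral_gap:
  obtains \<kappa> where "\<kappa> > 0"
    "\<And>y b. \<lbrakk>\<And>t. (y has_real_derivative z t * b t) (at t); continuous_on UNIV b;
       \<And>t. y (t + pi) = - y t; \<And>t. b (t + pi) = - b t;
       integral {0..pi} (\<lambda>t. (w t * y t) *\<^sub>R v t) = 0\<rbrakk>
       \<Longrightarrow> energy y \<le> \<kappa> * (dual_energy b - energy y)"
proof -
  obtain B where B: "B > 0" "\<And>s t. \<bar>det2 (v s) (v t)\<bar> \<le> B"
    using v_bounded by blast
  obtain m where m: "m > 0" "\<And>c. c \<in> {0..pi} \<Longrightarrow> det2 (v c) (v (c + pi / 2)) \<ge> m"
    using det_vv_quarter_bound by blast
  define W where "W = integral {0..pi} w"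
  have W: "W > 0" unfolding W_def using W_pos[of 0] by simp
  \<comment> \<open>\<open>B ^ 3\<close> bounds the three determinants in the Picone bound,
    \<open>W\<close> comes from integrating that bound against \<open>w\<close>, and
    \<open>m\<^sup>2\<close> is a lower bound for the square of \<eta> at the midpoint.\<close>
  define \<kappa> where "\<kappa> = B ^ 3 * W / m\<^sup>2"
  have "\<kappa> > 0" unfolding \<kappa>_def using B W m by simp
  then show thesis
  proof (rule that)
    fix y b :: "real \<Rightarrow> real"
    assume y_deriv: "\<And>t. (y has_real_derivative z t * b t) (at t)"
      and b_cont: "continuous_on UNIV b"
      and y_anti: "\<And>t. y (t + pi) = - y t" and b_anti: "\<And>t. b (t + pi) = - b t"
      and orth: "integral {0..pi} (\<lambda>t. (w t * y t) *\<^sub>R v t) = 0"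
    have y_cont: "continuous_on S y" for S
      using y_deriv by (meson DERIV_isCont continuous_at_imp_continuous_on)
    note cont = y_cont continuous_on_subset[OF b_cont] continuous_on_subset[OF w_cont]
      continuous_on_subset[OF z_cont] v_cont
    \<comment> \<open>Antiperiodicity gives \<open>y\<close> opposite signs at 0 and
      \<open>pi\<close>; the zero found here anchors the comparison function.\<close>
    have "\<exists>c\<ge>0. c \<le> pi \<and> y c = 0"
    proof (cases "y 0 \<le> 0")
      case True
      then show ?thesis using y_anti[of 0] IVT'[of y 0 0 pi] y_cont by force
    next
      case False
      then show ?thesis using y_anti[of 0] IVT2'[of y pi 0 0] y_cont by force
    qed
    then obtain c where c: "0 \<le> c" "c \<le> pi" "y c = 0" by blast
    let ?q = "\<lambda>t. z t * (b t)\<^sup>2 - w t * (y t)\<^sup>2"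
    have q_cont: "continuous_on UNIV ?q"
      by (intro continuous_intros cont) auto
    obtain \<Phi> where \<Phi>: "\<And>t. (\<Phi> has_vector_derivative ?q t) (at t)"
      "\<And>a b. a \<le> b \<Longrightarrow> integral {a..b} ?q = \<Phi> b - \<Phi> a"
      using antiderivative_exists[OF q_cont] by blast
    define Q where "Q = \<Phi> (c + pi) - \<Phi> c"
    note pb = picone_bound[OF y_deriv \<Phi>(1)[folded has_real_derivative_iff_has_vector_derivative] c(3)]
    have y0: "y (c + pi) = 0" using c y_anti by simp
    have Q0: "Q \<ge> 0" using pb(1)[OF y0] by (simp add: Q_def)
    have "Q = integral {c..c + pi} ?q" using \<Phi>(2) by (simp add: Q_def)
    also have "\<dots> = integral {0..pi} ?q"
      by (rule integral_period_shift[OF q_cont])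
        (simp add: has_period_def y_anti b_anti w_periodic z_periodic)
    also have "\<dots> = dual_energy b - energy y"
      unfolding energy_def dual_energy_def
      by (intro integral_diff integrable_continuous_real continuous_intros cont) auto
    finally have Q_eq: "Q = dual_energy b - energy y" .
    define \<eta> where "\<eta> t = det2 (v c) (v t)" for t
    define a where "a = c + pi / 2"
    have \<eta>_cont: "continuous_on S \<eta>" for S
      unfolding \<eta>_def by (intro continuous_intros cont)
    have tri: "\<eta> s * \<eta> t * det2 (v s) (v t) \<le> B ^ 3" for s t
    proof -
      have "\<eta> s * \<eta> t * det2 (v s) (v t) \<le> \<bar>\<eta> s\<bar> * \<bar>\<eta> t\<bar> * \<bar>det2 (v s) (v t)\<bar>"
        by (simp flip: abs_mult)
      also have "\<dots> \<le> B * B * B"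
        unfolding \<eta>_def using B by (intro mult_mono) auto
      finally show ?thesis by (simp add: power3_eq_cube)
    qed
    have inner: "(y t * \<eta> s - y s * \<eta> t)\<^sup>2 \<le> Q * B ^ 3" if "c < s" "s < t" "t < c + pi" for s t
      using pb(2)[OF y0 that] mult_left_mono[OF tri[of s t] Q0] unfolding Q_def \<eta>_def by linarith
    \<comment> \<open>The strict Picone bound, with one of its two points fixed at the midpoint
      \<open>a\<close>, covers the open half period except \<open>a\<close>; at \<open>a\<close> and
      at the ends the left side is 0.\<close>
    have D: "(y t * \<eta> a - y a * \<eta> t)\<^sup>2 \<le> Q * B ^ 3" if t: "t \<in> {c..c + pi}" for t
    proof -
      consider "t = c" | "t = c + pi" | "t = a" | "c < t" "t < a" | "a < t" "t < c + pi"
        using t by fastforce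
      then show ?thesis
      proof cases
        case 4
        then show ?thesis
          using inner[of t a] by (simp add: a_def power2_commute[of "y t * _"])
      next
        case 5
        then show ?thesis using inner[of a t] by (simp add: a_def)
      qed (use Q0 B c y0 in \<open>auto simp: \<eta>_def v_anti\<close>)
    qed
    define H where "H = integral {c..c + pi} (\<lambda>t. w t * (\<eta> t)\<^sup>2)"
    have H0: "H \<ge> 0"
      unfolding H_def using w_pos
      by (intro integral_nonneg integrable_continuous_real continuous_intros cont \<eta>_cont)
        (auto intro!: mult_nonneg_nonneg intro: less_imp_le)
    have E_shift: "integral {c..c + pi} (\<lambda>t. w t * (y t)\<^sup>2) = energy y"
      unfolding energy_def
      by (intro integral_period_shift continuous_intros cont) (auto simp: has_period_def w_periodic y_anti)
    have orth': "((\<lambda>t. w t * (y t * \<eta> t)) has_integral 0) {c..c + pi}"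
      unfolding \<eta>_def by (rule orthogonal_v_component[OF y_cont y_anti orth])
    have i1: "((\<lambda>t. w t * (y t)\<^sup>2) has_integral energy y) {c..c + pi}"
      unfolding E_shift[symmetric] by (intro integrable_integral integrable_continuous_real continuous_intros cont) auto
    have i2: "((\<lambda>t. w t * (\<eta> t)\<^sup>2) has_integral H) {c..c + pi}"
      unfolding H_def by (intro integrable_integral integrable_continuous_real continuous_intros cont \<eta>_cont) auto
    have W_shift: "integral {c..c + pi} w = W"
      unfolding W_def by (rule integral_period_shift[OF w_cont]) (simp add: has_period_def w_periodic)
    have i3: "(w has_integral W) {c..c + pi}"
      unfolding W_shift[symmetric] by (intro integrable_integral integrable_continuous_real cont) auto
    \<comment> \<open>Integral of \<open>w * (y * \<eta> a - y a * \<eta>)\<^sup>2\<close>.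
      Orthogonality removes the cross term, and the nonnegative term with \<open>H\<close> can then
      be dropped, which leaves the energy of \<open>y\<close> alone.\<close>
    have "((\<lambda>t. (\<eta> a)\<^sup>2 * (w t * (y t)\<^sup>2) - 2 * \<eta> a * y a * (w t * (y t * \<eta> t)) + (y a)\<^sup>2 * (w t * (\<eta> t)\<^sup>2))
        has_integral (\<eta> a)\<^sup>2 * energy y - 2 * \<eta> a * y a * 0 + (y a)\<^sup>2 * H) {c..c + pi}"
      by (intro has_integral_add has_integral_diff has_integral_mult_right i1 i2 orth')
    moreover have "((\<lambda>t. (Q * B ^ 3) * w t) has_integral (Q * B ^ 3) * W) {c..c + pi}"
      by (intro has_integral_mult_right i3)
    ultimately have "(\<eta> a)\<^sup>2 * energy y - 2 * \<eta> a * y a * 0 + (y a)\<^sup>2 * H \<le> (Q * B ^ 3) * W"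
    proof (rule has_integral_le)
      fix t assume t: "t \<in> {c..c + pi}"
      have "(\<eta> a)\<^sup>2 * (w t * (y t)\<^sup>2) - 2 * \<eta> a * y a * (w t * (y t * \<eta> t)) + (y a)\<^sup>2 * (w t * (\<eta> t)\<^sup>2)
          = (y t * \<eta> a - y a * \<eta> t)\<^sup>2 * w t"
        by (simp add: power2_eq_square algebra_simps)
      also have "\<dots> \<le> Q * B ^ 3 * w t"
        using D[OF t] w_pos[of t] by (intro mult_right_mono) auto
      finally show "(\<eta> a)\<^sup>2 * (w t * (y t)\<^sup>2) - 2 * \<eta> a * y a * (w t * (y t * \<eta> t)) + (y a)\<^sup>2 * (w t * (\<eta> t)\<^sup>2)
        \<le> Q * B ^ 3 * w t" .
    qed
    then have "(\<eta> a)\<^sup>2 * energy y \<le> Q * B ^ 3 * W"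
      using H0 by (smt (verit) mult_nonneg_nonneg mult_zero_right zero_le_power2)
    moreover have "m\<^sup>2 * energy y \<le> (\<eta> a)\<^sup>2 * energy y"
    proof (intro mult_right_mono power_mono)
      show "m \<le> \<eta> a" unfolding \<eta>_def a_def using m c by auto
      show "0 \<le> energy y"
        using i1 by (rule has_integral_nonneg) (use w_pos in \<open>auto intro!: mult_nonneg_nonneg intro: less_imp_le\<close>)
    qed (use m in auto)
    ultimately have "energy y * m\<^sup>2 \<le> Q * B ^ 3 * W"
      by (simp add: mult.commute)
    then have "energy y \<le> Q * B ^ 3 * W / m\<^sup>2"
      using m(1) by (simp add: pos_le_divide_eq)
    then show "energy y \<le> \<kappa> * (dual_energy b - energy y)"
      unfolding \<kappa>_def Q_eq[symmetric] by (simp add: mult_ac)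
  qed
qed

end

section \<open>Points of the region bounded by a curve\<close>

text \<open>For a continuous antiperiodic function this says that the zeros form one class modulo
  \<open>pi\<close>. Positivity on an arc is the form that suits perturbation and limits.\<close>

definition single_arch :: "(real \<Rightarrow> real) \<Rightarrow> bool" where
  "single_arch f \<longleftrightarrow> (\<exists>c. \<forall>t. c < t \<longrightarrow> t < c + pi \<longrightarrow> f t > 0)"

lemma arch_nonneg:
  fixes f :: "real \<Rightarrow> real"
  assumes "continuous_on UNIV f" "\<And>t. c < t \<Longrightarrow> t < c + pi \<Longrightarrow> f t > 0" "c \<le> t" "t \<le> c + pi"
  shows "f t \<ge> 0"
proof (rule continuous_ge_on_Ioo[of c "c + pi" f 0 t])
  show "continuous_on {c..c + pi} f"
    by (rule continuous_on_subset[OF assms(1)]) simp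
  show "f x \<ge> 0" if "x \<in> {c<..<c + pi}" for x
    using that by (intro less_imp_le assms(2)) auto
qed (use assms(3,4) pi_gt_zero in auto)

lemma arch_end_zero:
  fixes f :: "real \<Rightarrow> real"
  assumes "continuous_on UNIV f" "\<And>t. c < t \<Longrightarrow> t < c + pi \<Longrightarrow> f t > 0" "\<And>t. f (t + pi) = - f t"
  shows "f c = 0"
  using arch_nonneg[OF assms(1,2), of c c] arch_nonneg[OF assms(1,2), of c "c + pi"] assms(3)[of c] by simp

text \<open>Near the simple zero the derivative keeps its sign, so a perturbed function is strictly
  increasing and has one zero there; on the rest of the arc compactness keeps \<open>f\<close> away
  from 0.\<close>

lemma single_arch_perturb:
  fixes f f' :: "real \<Rightarrow> real"
  assumes f_deriv: "\<And>t. (f has_real_derivative f' t) (at t)" and f'_cont: "isCont f' c"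
    and f_pos: "\<And>t. c < t \<Longrightarrow> t < c + pi \<Longrightarrow> f t > 0" and f'_pos: "f' c > 0"
  obtains \<epsilon> where "\<epsilon> > 0"
    "\<And>g g'. \<lbrakk>\<And>t. (g has_real_derivative g' t) (at t); \<And>t. g (t + pi) = - g t;
      \<And>t. \<bar>g t - f t\<bar> < \<epsilon>; \<And>t. \<bar>g' t - f' t\<bar> < \<epsilon>\<rbrakk> \<Longrightarrow> single_arch g"
proof -
  have "\<forall>\<^sub>F t in at c. f' t > f' c / 2"
    using f'_cont f'_pos unfolding isCont_def by (intro order_tendstoD(1)) auto
  then obtain \<delta>0 where \<delta>0: "\<delta>0 > 0" "\<And>t. \<bar>t - c\<bar> < \<delta>0 \<Longrightarrow> t \<noteq> c \<Longrightarrow> f' t > f' c / 2"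
    unfolding eventually_at dist_real_def by auto
  define \<delta> where "\<delta> = min (\<delta>0 / 2) (pi / 4)"
  have \<delta>: "\<delta> > 0" "\<delta> \<le> pi / 4" "\<delta> < \<delta>0"
    using \<delta>0(1) by (auto simp: \<delta>_def min_def)
  have f'_large: "f' t > f' c / 2" if "\<bar>t - c\<bar> \<le> \<delta>" for t
    using \<delta>0(2)[of t] that \<delta> f'_pos by (cases "t = c") auto
  have f_cont: "continuous_on S f" for S
    using f_deriv by (meson DERIV_isCont continuous_at_imp_continuous_on)
  have "{c + \<delta>..c + pi - \<delta>} \<noteq> {}" using \<delta> by auto
  then obtain x where x: "x \<in> {c + \<delta>..c + pi - \<delta>}" "\<And>t. t \<in> {c + \<delta>..c + pi - \<delta>} \<Longrightarrow> f x \<le> f t"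
    using continuous_attains_inf[OF _ _ f_cont] by (metis compact_Icc)
  \<comment> \<open>The first entry preserves the sign of the derivative near \<open>c\<close>,
    where it exceeds \<open>f' c / 2\<close>; the second is the minimum of \<open>f\<close> on the
    middle part of the arc.\<close>
  define \<epsilon> where "\<epsilon> = min (f' c / 2) (f x)"
  show thesis
  proof (rule that[of \<epsilon>])
    show "\<epsilon> > 0" using f'_pos f_pos[of x] x(1) \<delta> by (auto simp: \<epsilon>_def)
    fix g g' assume g_deriv: "\<And>t. (g has_real_derivative g' t) (at t)"
      and g_anti: "\<And>t. g (t + pi) = - g t"
      and close: "\<And>t. \<bar>g t - f t\<bar> < \<epsilon>" "\<And>t. \<bar>g' t - f' t\<bar> < \<epsilon>"
    have \<epsilon>_le: "\<epsilon> \<le> f x" "\<epsilon> \<le> f' c / 2" by (auto simp: \<epsilon>_def)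
    have g_mid: "g t > 0" if "t \<in> {c + \<delta>..c + pi - \<delta>}" for t
      using close(1)[of t] x(2)[OF that] \<epsilon>_le by linarith
    have g'_pos: "g' t > 0" if "\<bar>t - c\<bar> \<le> \<delta>" for t
      using close(2)[of t] f'_large[OF that] \<epsilon>_le by linarith
    have g_less: "g s < g t" if "c - \<delta> \<le> s" "s < t" "t \<le> c + \<delta>" for s t
      using that by (intro DERIV_pos_imp_increasing[of s t g]) (auto intro!: exI g_deriv g'_pos)
    have "g (c - \<delta>) \<le> 0"
      using g_anti[of "c - \<delta>"] g_mid[of "c - \<delta> + pi"] \<delta> by auto
    moreover have "0 \<le> g (c + \<delta>)" using g_mid[of "c + \<delta>"] \<delta> by auto
    moreover have "continuous_on {c - \<delta>..c + \<delta>} g"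
      using g_deriv by (meson DERIV_isCont continuous_at_imp_continuous_on)
    ultimately obtain d where d: "c - \<delta> \<le> d" "d \<le> c + \<delta>" "g d = 0"
      using IVT'[of g "c - \<delta>" 0 "c + \<delta>"] \<delta> by auto
    have "g t > 0" if t: "d < t" "t < d + pi" for t
    proof -
      consider "t \<le> c + \<delta>" | "t \<in> {c + \<delta>..c + pi - \<delta>}" | "c + pi - \<delta> < t"
        by fastforce
      then show ?thesis
      proof cases
        case 1
        then show ?thesis using g_less[of d t] d t by simp
      next
        case 3
        then show ?thesis using g_less[of "t - pi" d] g_anti[of "t - pi"] d t by simp
      qed (rule g_mid)
    qed
    then show "single_arch g" unfolding single_arch_def by blast
  qed
qed

section \<open>Tangent lines through a point and the exterior of a curve\<close>

context dual_pair
begin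

text \<open>The eigenfunction \<open>[v c, v]\<close> is positive on the same arc as
  \<open>h\<close>, so its weighted product with \<open>h\<close> has a positive integral.\<close>

lemma single_arch_not_orthogonal:
  fixes h :: "real \<Rightarrow> real"
  assumes cont: "continuous_on UNIV h" and anti: "\<And>t. h (t + pi) = - h t"
    and orth: "integral {0..pi} (\<lambda>t. (w t * h t) *\<^sub>R v t) = 0"
  shows "\<not> single_arch h"
proof
  assume "single_arch h"
  then obtain c where c: "\<And>t. c < t \<Longrightarrow> t < c + pi \<Longrightarrow> h t > 0"
    unfolding single_arch_def by blast
  define q where "q t = w t * (h t * det2 (v c) (v t))" for t
  have q_cont: "continuous_on {c..c + pi} q"
    unfolding q_def by (intro continuous_intros v_cont continuous_on_subset[OF cont] continuous_on_subset[OF w_cont]) auto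
  have q_pos: "q t > 0" if "c < t" "t < c + pi" for t
    unfolding q_def using that c det_vv_pos w_pos by simp
  have "q t \<ge> 0" if "t \<in> {c..c + pi}" for t
    by (rule continuous_ge_on_Ioo[OF q_cont _ _ that]) (auto intro: less_imp_le q_pos)
  moreover have "integral {c..c + pi} q = 0"
    using orthogonal_v_component[OF cont anti orth] unfolding q_def by (rule integral_unique)
  ultimately have "\<forall>t\<in>{c..c + pi}. q t = 0"
    using integral_eq_0_iff[OF q_cont] by simp
  then show False
    using q_pos[of "c + pi / 2"] by auto
qed

text \<open>
  The zeros of \<open>[K - x, v]\<close> modulo \<open>pi\<close> are the tangent lines of \<open>K\<close> through \<open>x\<close>. As a zero is
  double only if \<open>x\<close> lies on \<open>K\<close>, the property of having exactly one zero modulo \<open>pi\<close> is open and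
  closed on the exterior of \<open>K\<close>, and it holds far away from \<open>K\<close>.
\<close>

lemma outside_imp_single_arch:
  fixes K :: "real \<Rightarrow> real ^ 2"
  assumes K_deriv: "\<And>t. (K has_vector_derivative a t *\<^sub>R v t) (at t)"
    and K_periodic: "\<And>t. K (t + pi) = K t"
    and x: "x \<in> outside (range K)"
  shows "single_arch (\<lambda>t. det2 (K t - x) (v t))"
proof -
  define h where "h x t = det2 (K t - x) (v t)" for x t
  define h' where "h' x t = - (z t * det2 (K t - x) (u t))" for x t
  have K_x_deriv: "((\<lambda>t. K t - x) has_vector_derivative a t *\<^sub>R v t) (at t)" for x t
    by (auto intro!: derivative_eq_intros K_deriv)
  have h_deriv: "(h x has_real_derivative h' x t) (at t)" for x t
    unfolding has_real_derivative_iff_has_vector_derivative h_def h'_def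
    using det2_has_vector_derivative[OF K_x_deriv v_deriv, of x t] by simp
  have h_anti: "h x (t + pi) = - h x t" for x t
    by (simp add: h_def K_periodic v_anti)
  have h_cont: "continuous_on S (h x)" for S x
    using h_deriv by (meson DERIV_isCont continuous_at_imp_continuous_on)
  have K_cont: "continuous_on S K" for S
    using K_deriv by (rule continuous_on_if_has_vector_derivative)
  have h'_cont: "isCont (h' x) t" for x t
  proof -
    have "continuous_on UNIV (h' x)"
      unfolding h'_def by (intro continuous_intros K_cont u_cont z_cont)
    then show ?thesis by (simp add: continuous_on_eq_continuous_at)
  qed
  have h_period: "has_period (2 * pi) (h x)" for x
    unfolding has_period_def using h_anti by (metis add.assoc minus_minus mult_2)
  have "has_period pi K" by (simp add: has_period_def K_periodic)
  then obtain CK where CK: "CK > 0" "\<And>t. norm (K t) \<le> CK"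
    using has_period_bounded[of pi K] K_cont by auto
  have "has_period (2 * pi) v" "has_period (2 * pi) (\<lambda>t. z t *\<^sub>R u t)"
    unfolding has_period_def using v_anti u_anti z_periodic by (metis add.assoc minus_minus mult_2)+
  moreover have "continuous_on UNIV (\<lambda>t. z t *\<^sub>R u t)"
    by (intro continuous_intros u_cont z_cont)
  ultimately obtain Cv Cu where Cv: "Cv > 0" "\<And>t. norm (v t) \<le> Cv"
    and Cu: "Cu > 0" "\<And>t. norm (z t *\<^sub>R u t) \<le> Cu"
    using has_period_bounded[of "2 * pi" v] has_period_bounded[of "2 * pi" "\<lambda>t. z t *\<^sub>R u t"] v_cont
    by (metis mult_pos_pos pi_gt_zero zero_less_numeral)
  define C where "C = 2 * (Cv + Cu)"
  have C: "C > 0" using Cv Cu by (simp add: C_def)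
  have C_v: "\<bar>det2 y (v t)\<bar> \<le> norm y * C" for y t
  proof -
    have "2 * norm y * norm (v t) \<le> 2 * norm y * (Cv + Cu)"
      using Cv(2)[of t] Cu(1) by (intro mult_left_mono) auto
    then show ?thesis
      using abs_det2_le[of y "v t"] by (simp add: C_def algebra_simps)
  qed
  have C_u: "\<bar>z t * det2 y (u t)\<bar> \<le> norm y * C" for y t
  proof -
    have "2 * norm y * norm (z t *\<^sub>R u t) \<le> 2 * norm y * (Cv + Cu)"
      using Cu(2)[of t] Cv(1) by (intro mult_left_mono) auto
    then show ?thesis
      using abs_det2_le[of y "z t *\<^sub>R u t"] by (simp add: C_def algebra_simps)
  qed
  define U where "U = outside (range K)"
  define S where "S = {x. single_arch (h x)}"
  have K_compact: "compact (range K)"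
  proof -
    have "range K = K ` {0..pi}"
    proof (intro equalityI subsetI)
      fix y assume "y \<in> range K"
      then obtain t where "y = K t" by blast
      moreover obtain s where "0 \<le> s" "s < pi" "K (t + 0) = K (s + 0)"
        using has_period_reduce[OF \<open>has_period pi K\<close> pi_gt_zero, of t] by metis
      ultimately show "y \<in> K ` {0..pi}" by (intro image_eqI[of _ _ s]) auto
    qed auto
    then show ?thesis using K_cont by (metis compact_Icc compact_continuous_image)
  qed
  have not_on_curve: "K t \<noteq> x" if "x \<in> U" for x t
    using outside_no_overlap[of "range K"] that unfolding U_def by blast
  \<comment> \<open>A double zero means that both \<open>[K t - x, u t]\<close> and
    \<open>[K t - x, v t]\<close> vanish; as \<open>u t\<close> and \<open>v t\<close> form a basis,
    \<open>x\<close> would lie on the curve.\<close>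
  have not_double: "h' x t \<noteq> 0" if "x \<in> U" "h x t = 0" for x t
  proof
    assume "h' x t = 0"
    then have "det2 (K t - x) (u t) = 0" using z_pos[of t] by (simp add: h'_def)
    then have "K t = x" using that(2) det_uv[of t] det2_eq_zero_imp_eq unfolding h_def by blast
    then show False using not_on_curve that(1) by blast
  qed
  have "open (U \<inter> S)"
  proof (rule openI)
    fix x assume x: "x \<in> U \<inter> S"
    then obtain c where c: "\<And>t. c < t \<Longrightarrow> t < c + pi \<Longrightarrow> h x t > 0"
      unfolding S_def single_arch_def by blast
    have hc: "h x c = 0" using arch_end_zero[OF h_cont c h_anti] by blast
    \<comment> \<open>A negative slope at the zero \<open>c\<close> would make the function negative
      immediately to its right, inside the arch.\<close>
    have "\<not> h' x c < 0"
    proof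
      assume "h' x c < 0"
      then obtain d where d: "d > 0" "\<And>r. 0 < r \<Longrightarrow> r < d \<Longrightarrow> h x (c + r) < h x c"
        using DERIV_neg_dec_right[OF h_deriv] by blast
      define r where "r = min d pi / 2"
      have "0 < r" "r < d" "r < pi" using d(1) pi_gt_zero unfolding r_def by linarith+
      then show False using c[of "c + r"] d(2)[of r] hc by simp
    qed
    moreover have "h' x c \<noteq> 0" using not_double[OF _ hc] x by blast
    ultimately have "h' x c > 0" by linarith
    from single_arch_perturb[OF h_deriv h'_cont c this]
    obtain \<epsilon> where \<epsilon>: "\<epsilon> > 0"
      "\<And>g g'. \<lbrakk>\<And>t. (g has_real_derivative g' t) (at t); \<And>t. g (t + pi) = - g t;
      \<And>t. \<bar>g t - h x t\<bar> < \<epsilon>; \<And>t. \<bar>g' t - h' x t\<bar> < \<epsilon>\<rbrakk> \<Longrightarrow> single_arch g"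
      by blast
    have "ball x (\<epsilon> / C) \<subseteq> S"
    proof
      fix y assume "y \<in> ball x (\<epsilon> / C)"
      then have y: "norm (x - y) * C < \<epsilon>" using C by (simp add: dist_norm pos_less_divide_eq)
      have "single_arch (h y)"
      proof (rule \<epsilon>(2)[OF h_deriv h_anti])
        fix t
        have "h y t - h x t = det2 (x - y) (v t)" by (simp add: h_def)
        then show "\<bar>h y t - h x t\<bar> < \<epsilon>" using C_v[of "x - y" t] y by simp
        have "h' y t - h' x t = - (z t * det2 (x - y) (u t))" by (simp add: h'_def algebra_simps)
        then show "\<bar>h' y t - h' x t\<bar> < \<epsilon>" using C_u[of t "x - y"] y by simp
      qed
      then show "y \<in> S" by (simp add: S_def)
    qed
    moreover obtain r where "r > 0" "ball x r \<subseteq> U"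
      using open_outside[OF compact_imp_closed[OF K_compact]] x unfolding U_def
      by (metis IntD1 open_contains_ball)
    ultimately show "\<exists>e>0. ball x e \<subseteq> U \<inter> S"
      using \<epsilon>(1) C by (intro exI[of _ "min r (\<epsilon> / C)"]) auto
  qed
  then have "openin (top_of_set U) (U \<inter> S)" by (intro open_subset) auto
  \<comment> \<open>Weak inequalities and a starting point in a compact interval make this set
    closed. On the exterior it agrees with \<open>S\<close>: an interior zero of a nonnegative arch
    is a local minimum, hence a double zero.\<close>
  define S' where "S' = {x. \<exists>c\<in>{0..2 * pi}. \<forall>t\<in>{0..pi}. h x (c + t) \<ge> 0}"
  have "closed S'"
    unfolding closed_sequential_limits
  proof (intro allI impI, elim conjE)
    fix X l assume "\<forall>n. X n \<in> S'" and X: "X \<longlonglongrightarrow> l"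
    then obtain c where c: "\<And>n. c n \<in> {0..2 * pi}" "\<And>n t. t \<in> {0..pi} \<Longrightarrow> h (X n) (c n + t) \<ge> 0"
      unfolding S'_def mem_Collect_eq by metis
    obtain c0 r where r: "c0 \<in> {0..2 * pi}" "strict_mono r" "(c \<circ> r) \<longlonglongrightarrow> c0"
      using compact_Icc[of 0 "2 * pi"] c(1) unfolding compact_def by meson
    have "h l (c0 + t) \<ge> 0" if t: "t \<in> {0..pi}" for t
    proof -
      have lim: "(\<lambda>n. c (r n) + t) \<longlonglongrightarrow> c0 + t"
        using r(3) by (intro tendsto_intros) (simp add: o_def)
      have "(\<lambda>n. X (r n)) \<longlonglongrightarrow> l" using LIMSEQ_subseq_LIMSEQ[OF X r(2)] by (simp add: o_def)
      moreover have "(\<lambda>n. K (c (r n) + t)) \<longlonglongrightarrow> K (c0 + t)" "(\<lambda>n. v (c (r n) + t)) \<longlonglongrightarrow> v (c0 + t)"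
        using K_cont[of UNIV] v_cont[of UNIV] lim by (auto intro: continuous_on_tendsto_compose)
      ultimately have "(\<lambda>n. h (X (r n)) (c (r n) + t)) \<longlonglongrightarrow> h l (c0 + t)"
        unfolding h_def by (intro bounded_bilinear.tendsto[OF bounded_bilinear_det2] tendsto_diff)
      then show ?thesis
        by (rule LIMSEQ_le_const) (use c(2) t in blast)
    qed
    then show "l \<in> S'" unfolding S'_def using r(1) by blast
  qed
  moreover have "U \<inter> S = U \<inter> S'"
  proof (intro equalityI subsetI IntI; elim IntE)
    fix x assume "x \<in> S"
    then obtain c where c: "\<And>t. c < t \<Longrightarrow> t < c + pi \<Longrightarrow> h x t > 0"
      unfolding S_def single_arch_def by blast
    obtain s where s: "0 \<le> s" "s < 2 * pi" "\<And>r. h x (c + r) = h x (s + r)"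
      using has_period_reduce[where t = c, OF h_period[of x]] by auto
    have "h x (c + t) \<ge> 0" if "t \<in> {0..pi}" for t
      using that by (intro arch_nonneg[OF h_cont c]) auto
    then show "x \<in> S'" unfolding S'_def using s by (auto intro!: bexI[of _ s])
  next
    fix x assume x: "x \<in> U" "x \<in> S'"
    then obtain c where c: "\<And>t. t \<in> {0..pi} \<Longrightarrow> h x (c + t) \<ge> 0"
      unfolding S'_def by blast
    have "h x t > 0" if t: "c < t" "t < c + pi" for t
    proof -
      have ge: "h x s \<ge> 0" if "c \<le> s" "s \<le> c + pi" for s
        using c[of "s - c"] that by simp
      have "h x t \<noteq> 0"
      proof
        assume h0: "h x t = 0"
        have "h' x t = 0"
          by (rule DERIV_local_min[OF h_deriv, of "min (t - c) (c + pi - t)"])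
            (use t h0 ge in \<open>auto simp: abs_if split: if_splits\<close>)
        then show False using not_double x(1) h0 by blast
      qed
      then show ?thesis using ge[of t] t by simp
    qed
    then show "x \<in> S" unfolding S_def single_arch_def by blast
  qed
  ultimately have "closedin (top_of_set U) (U \<inter> S)"
    by (simp add: closedin_closed_Int)
  moreover have "connected U"
    unfolding U_def by (intro connected_outside compact_imp_bounded K_compact) simp
  ultimately have "U \<inter> S = {} \<or> U \<inter> S = U"
    using \<open>openin (top_of_set U) (U \<inter> S)\<close> unfolding connected_clopen by blast
  moreover have "U \<inter> S \<noteq> {}"
  proof -
    let ?f = "\<lambda>t. det2 (v 0) (v t)" and ?f' = "\<lambda>t. - (z t * det2 (v 0) (u t))"
    have "continuous_on UNIV ?f'" by (intro continuous_intros u_cont z_cont)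
    then have cont: "isCont ?f' 0" by (simp add: continuous_on_eq_continuous_at)
    have pos: "?f' 0 > 0"
      using det2_swap[of "v 0" "u 0"] det_uv[of 0] z_pos[of 0] by simp
    have "?f t > 0" if "0 < t" "t < 0 + pi" for t using that by (rule det_vv_pos)
    then obtain \<epsilon> where \<epsilon>: "\<epsilon> > 0"
      "\<And>g g'. \<lbrakk>\<And>t. (g has_real_derivative g' t) (at t); \<And>t. g (t + pi) = - g t;
      \<And>t. \<bar>g t - ?f t\<bar> < \<epsilon>; \<And>t. \<bar>g' t - ?f' t\<bar> < \<epsilon>\<rbrakk> \<Longrightarrow> single_arch g"
      using single_arch_perturb[of ?f ?f' 0, OF det_left_v_deriv cont _ pos] by blast
    obtain Bd where Bd: "\<And>x. x \<notin> U \<Longrightarrow> norm x \<le> Bd"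
      using cobounded_outside[OF compact_imp_bounded[OF K_compact]] unfolding U_def bounded_iff by auto
    have v0: "norm (v 0) > 0" using det_uv[of 0] by (metis det2_linear_simps(8) zero_less_norm_iff zero_neq_one)
    \<comment> \<open>The first summand makes the contribution of \<open>K\<close> smaller than
      \<epsilon> after division by \<open>R\<close>, the second moves \<open>x\<close> out of the
      ball containing the complement of \<open>U\<close>, and 1 makes both estimates strict.\<close>
    define R where "R = CK * C / \<epsilon> + \<bar>Bd\<bar> / norm (v 0) + 1"
    have "CK * C / \<epsilon> \<ge> 0" "\<bar>Bd\<bar> / norm (v 0) \<ge> 0" using CK C \<epsilon>(1) by auto
    then have R: "R > 0" "CK * C / \<epsilon> < R" "\<bar>Bd\<bar> / norm (v 0) < R" unfolding R_def by linarith+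
    define x where "x = - (R *\<^sub>R v 0)"
    have "norm x > Bd" using R v0 by (simp add: x_def pos_divide_less_eq)
    then have "x \<in> U" using Bd by force
    moreover have "single_arch (\<lambda>t. h x t / R)"
    proof (rule \<epsilon>(2))
      fix t
      show "((\<lambda>t. h x t / R) has_real_derivative h' x t / R) (at t)"
        using h_deriv by (rule DERIV_cdivide)
      show "h x (t + pi) / R = - (h x t / R)" by (simp add: h_anti)
      have "norm (K t) * C \<le> CK * C" using CK C by (intro mult_right_mono) auto
      also have "\<dots> < \<epsilon> * R" using R(2) \<epsilon>(1) by (simp add: pos_divide_less_eq mult.commute)
      finally have *: "norm (K t) * C < \<epsilon> * R" .
      have "h x t / R - ?f t = det2 (K t) (v t) / R"
        using R(1) by (simp add: h_def x_def field_simps)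
      then show "\<bar>h x t / R - ?f t\<bar> < \<epsilon>"
        using C_v[of "K t" t] * R(1) by (simp add: pos_divide_less_eq)
      have "h' x t / R - ?f' t = - (z t * det2 (K t) (u t)) / R"
        using R(1) by (simp add: h'_def x_def field_simps)
      then show "\<bar>h' x t / R - ?f' t\<bar> < \<epsilon>"
        using C_u[of t "K t"] * R(1) by (simp add: pos_divide_less_eq)
    qed
    then have "single_arch (h x)"
      using R(1) unfolding single_arch_def by (simp add: zero_less_divide_iff)
    ultimately show ?thesis unfolding S_def by blast
  qed
  ultimately show ?thesis using x unfolding U_def S_def h_def by blast
qed

lemma in_region_if_orthogonal:
  fixes K :: "real \<Rightarrow> real ^ 2"
  assumes "\<And>t. (K has_vector_derivative a t *\<^sub>R v t) (at t)" "\<And>t. K (t + pi) = K t"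
    and "integral {0..pi} (\<lambda>t. (w t * det2 (K t - p) (v t)) *\<^sub>R v t) = 0"
  shows "p \<in> region_bounded_by K"
proof -
  have "continuous_on UNIV (\<lambda>t. det2 (K t - p) (v t))"
    using continuous_on_if_has_vector_derivative[OF assms(1)]
    by (intro continuous_intros v_cont)
  then have "\<not> single_arch (\<lambda>t. det2 (K t - p) (v t))"
    using assms(2,3) by (intro single_arch_not_orthogonal) (auto simp: v_anti)
  then show ?thesis
    unfolding region_bounded_by_def using outside_imp_single_arch[OF assms(1,2)] by blast
qed

end

section \<open>Iterated involutes\<close>

lemma uniform_limit_Suc_iff:
  "uniform_limit S (\<lambda>i. F (Suc i)) f sequentially \<longleftrightarrow> uniform_limit S F f sequentially"
proof -
  have "(\<forall>\<^sub>F i in sequentially. \<forall>x\<in>S. dist (F (Suc i) x) (f x) < e) \<longleftrightarrow>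
      (\<forall>\<^sub>F i in sequentially. \<forall>x\<in>S. dist (F i x) (f x) < e)" for e
    by (rule eventually_sequentially_Suc[of "\<lambda>i. \<forall>x\<in>S. dist (F i x) (f x) < e"])
  then show ?thesis unfolding uniform_limit_iff by simp
qed

lemma null_upto_Suc_iff: "null_upto n (\<lambda>i. F (Suc i)) \<longleftrightarrow> null_upto n F"
proof -
  have "uniform_limit UNIV (\<lambda>i. nth_derivative j (F (Suc i))) (\<lambda>_. 0) sequentially \<longleftrightarrow>
      uniform_limit UNIV (\<lambda>i. nth_derivative j (F i)) (\<lambda>_. 0) sequentially" for j
    by (rule uniform_limit_Suc_iff[where F = "\<lambda>i. nth_derivative j (F i)"])
  then show ?thesis unfolding null_upto_iff by simp
qed

text \<open>Antiperiodicity doubles the boundary term of the moving integral and the factor 1/2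
  undoes this; the formula thus selects the antiperiodic primitive of \<open>- f\<close>.\<close>

lemma half_period_integral:
  fixes f g :: "real \<Rightarrow> real"
  assumes cont: "continuous_on UNIV f" and anti: "\<And>t. f (t + pi) = - f t"
    and g: "\<And>t. g t = (1 / 2) * integral {t..t + pi} f"
  shows "(g has_real_derivative - f t) (at t)" and "g (t + pi) = - g t"
proof -
  have "((\<lambda>t. (1 / 2) * integral {t..t + pi} f) has_real_derivative (1 / 2) * (f (t + pi) - f t)) (at t)"
    using integral_half_period_has_vector_derivative[OF cont, of t]
    unfolding has_real_derivative_iff_has_vector_derivative [symmetric] by (rule DERIV_cmult)
  moreover have "(\<lambda>t. (1 / 2) * integral {t..t + pi} f) = g" using g by auto
  ultimately show "(g has_real_derivative - f t) (at t)" by (simp add: anti)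
  show "g (t + pi) = - g t"
    using integral_antiperiodic[OF cont anti, of t] by (simp add: g)
qed

lemma integral_periodic_derivative_zero:
  fixes f :: "real \<Rightarrow> 'a::euclidean_space"
  assumes "\<And>t. (f has_vector_derivative f' t) (at t)" "f (a + pi) = f a"
  shows "(f' has_integral 0) {a..a + pi}"
  using fundamental_theorem_of_calculus[of a "a + pi" f f'] assms
  by (auto intro: has_vector_derivative_at_within)

text \<open>Integrating \<open>F'\<close> over \<open>{s..t}\<close> and passing to the limit avoids
  any assumption on the derivative of \<open>f\<close>.\<close>

lemma uniform_limit_constant_if_derivative_null:
  fixes F :: "nat \<Rightarrow> real \<Rightarrow> 'a::euclidean_space"
  assumes deriv: "\<And>i t. (F i has_vector_derivative F' i t) (at t)"
    and cont: "\<And>i. continuous_on UNIV (F' i)"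
    and null: "uniform_limit UNIV F' (\<lambda>_. 0) sequentially"
    and lim: "uniform_limit UNIV F f sequentially"
  shows "f = (\<lambda>_. f 0)"
proof -
  have eq: "f s = f t" if "s \<le> t" for s t
  proof -
    have "uniform_limit {s..t} F' (\<lambda>_. 0) sequentially"
      using null by (rule uniform_limit_on_subset) simp
    then obtain I J where I: "\<And>i. (F' i has_integral I i) {s..t}"
      "((\<lambda>_. 0 :: 'a) has_integral J) {s..t}" "I \<longlonglongrightarrow> J"
      using continuous_on_subset[OF cont] by (rule uniform_limit_integral) auto
    have "(F' i has_integral F i t - F i s) {s..t}" for i
      using deriv that by (intro fundamental_theorem_of_calculus) (auto intro: has_vector_derivative_at_within)
    then have "I = (\<lambda>i. F i t - F i s)" using I(1) has_integral_unique by blast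
    moreover have "J = 0" using I(2) has_integral_0 has_integral_unique by blast
    ultimately have "(\<lambda>i. F i t - F i s) \<longlonglongrightarrow> 0" using I(3) by simp
    moreover have "(\<lambda>i. F i t - F i s) \<longlonglongrightarrow> f t - f s"
      using lim by (intro tendsto_diff tendsto_uniform_limitI) auto
    ultimately have "f t - f s = 0" using LIMSEQ_unique by blast
    then show ?thesis by simp
  qed
  show ?thesis using eq[of 0] eq[of _ 0] by (metis linear)
qed

context dual_pair
begin

text \<open>
  Passing from \<open>K i\<close> to \<open>K (Suc i)\<close> does not change \<open>\<integral> [K i - p, v] w v\<close>, so this integral is
  equal to its limit 0.
\<close>

lemma limit_in_regions:
  assumes K_deriv: "\<And>i t. (K i has_vector_derivative a i t *\<^sub>R v t) (at t)"
    and K_periodic: "\<And>i t. K i (t + pi) = K i t"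
    and step: "\<And>i t. K (Suc i) t = K i t + b i t *\<^sub>R v t + c i t *\<^sub>R u t"
    and c_cont: "\<And>i. continuous_on UNIV (c i)"
    and orth: "\<And>i. integral {0..pi} (\<lambda>t. (w t * c i t) *\<^sub>R v t) = 0"
    and lim: "uniform_limit UNIV K (\<lambda>_. p) sequentially"
  shows "p \<in> region_bounded_by (K i)"
proof -
  define h where "h i t = det2 (K i t - p) (v t)" for i t
  define I where "I i = integral {0..pi} (\<lambda>t. (w t * h i t) *\<^sub>R v t)" for i
  have K_cont: "continuous_on S (K i)" for S i
    using K_deriv by (rule continuous_on_if_has_vector_derivative)
  have h_cont: "continuous_on S (h i)" for S i
    unfolding h_def by (intro continuous_intros K_cont v_cont)
  have cont: "continuous_on S (\<lambda>t. (w t * h i t) *\<^sub>R v t)" "continuous_on S (\<lambda>t. (w t * c i t) *\<^sub>R v t)" for S i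
    by (intro continuous_intros v_cont h_cont continuous_on_subset[OF w_cont]
        continuous_on_subset[OF c_cont]; simp)+
  have "I (Suc i) = I i" for i
  proof -
    \<comment> \<open>The determinant with \<open>v\<close> annihilates the displacement along
      \<open>v\<close>, and \<open>[u, v] = 1\<close> leaves just the coefficient of
      \<open>u\<close>.\<close>
    have "h (Suc i) t = h i t + c i t" for t
      by (simp add: h_def step det_uv)
    then have "I (Suc i) = integral {0..pi} (\<lambda>t. (w t * h i t) *\<^sub>R v t + (w t * c i t) *\<^sub>R v t)"
      unfolding I_def by (simp add: algebra_simps)
    also have "\<dots> = I i + integral {0..pi} (\<lambda>t. (w t * c i t) *\<^sub>R v t)"
      unfolding I_def by (intro integral_add integrable_continuous_real cont)
    finally show ?thesis by (simp add: orth)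
  qed
  then have I_const: "I j = I i" for j
  proof -
    assume *: "\<And>i. I (Suc i) = I i"
    have "I n = I 0" for n by (induction n) (simp_all add: *)
    then show "I j = I i" by metis
  qed
  have diff_lim: "uniform_limit UNIV (\<lambda>i t. K i t - p) (\<lambda>_. 0) sequentially"
    using uniform_limit_minus[OF lim uniform_limit_const[where c = "\<lambda>_. p"]] by simp
  have v_period: "has_period (2 * pi) v"
    unfolding has_period_def using v_anti by (metis add.assoc minus_minus mult_2)
  moreover have "has_period (2 * pi) w"
    unfolding has_period_def using w_periodic by (metis add.assoc mult_2)
  ultimately have "has_period (2 * pi) (\<lambda>t. w t *\<^sub>R v t)"
    by (simp add: has_period_def)
  moreover have "continuous_on UNIV (\<lambda>t. w t *\<^sub>R v t)"
    by (intro continuous_intros v_cont w_cont)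
  ultimately obtain C where "C > 0" and C: "\<And>t. norm (w t *\<^sub>R v t) \<le> C"
    using has_period_bounded[of "2 * pi" "\<lambda>t. w t *\<^sub>R v t"] by auto
  obtain B where "B > 0" and B: "\<And>t. norm (v t) \<le> B"
    using has_period_bounded[OF v_period] v_cont by auto
  have "uniform_limit UNIV h (\<lambda>_. 0) sequentially"
    unfolding h_def
    by (rule uniform_limit_bilinear_bounded[OF bounded_bilinear.flip[OF bounded_bilinear_det2] diff_lim B])
  from uniform_limit_bilinear_bounded[where c = "\<lambda>t. w t *\<^sub>R v t",
      OF bounded_bilinear.flip[OF bounded_bilinear_scaleR] this C]
  have "uniform_limit UNIV (\<lambda>i t. (w t * h i t) *\<^sub>R v t) (\<lambda>_. 0) sequentially"
    by (simp add: mult.commute)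
  then have "uniform_limit {0..pi} (\<lambda>i t. (w t * h i t) *\<^sub>R v t) (\<lambda>_. 0) sequentially"
    by (rule uniform_limit_on_subset) simp
  then obtain I' J where I': "\<And>i. ((\<lambda>t. (w t * h i t) *\<^sub>R v t) has_integral I' i) {0..pi}"
    "((\<lambda>_. 0 :: real ^ 2) has_integral J) {0..pi}" "I' \<longlonglongrightarrow> J"
    using cont(1) by (rule uniform_limit_integral) auto
  have "I' = I" unfolding I_def using I'(1) by (auto intro: integral_unique[symmetric])
  moreover have "J = 0" using I'(2) has_integral_0 has_integral_unique by blast
  ultimately have "I \<longlonglongrightarrow> 0" using I'(3) by simp
  moreover have "I = (\<lambda>_. I i)" using I_const by blast
  ultimately have "I i = 0" by (metis LIMSEQ_const_iff)
  then show ?thesis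
    unfolding I_def h_def by (intro in_region_if_orthogonal[OF K_deriv K_periodic])
qed

end

locale iterated_involutes = dual_pair +
  fixes \<alpha> \<beta> :: "nat \<Rightarrow> real \<Rightarrow> real" and M N :: "nat \<Rightarrow> real \<Rightarrow> real ^ 2"
  assumes u_smooth: "smooth u" and v_smooth: "smooth v" and w_smooth: "smooth w" and z_smooth: "smooth z"
    and \<alpha>0_smooth: "smooth (\<alpha> 0)" and \<alpha>0_anti: "\<alpha> 0 (t + pi) = - \<alpha> 0 t"
    and \<beta>_Suc: "\<beta> (Suc i) t = (1 / 2) * integral {t..t + pi} (\<lambda>s. \<alpha> i s * w s)"
    and \<alpha>_Suc: "\<alpha> (Suc i) t = - (1 / 2) * integral {t..t + pi} (\<lambda>s. \<beta> (Suc i) s * z s)"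
    and M0_deriv: "(M 0 has_vector_derivative \<alpha> 0 t *\<^sub>R w t *\<^sub>R v t) (at t)"
    and M0_periodic: "M 0 (t + pi) = M 0 t"
    and N_Suc: "N (Suc i) t = M i t + \<beta> (Suc i) t *\<^sub>R v t"
    and M_Suc: "M (Suc i) t = N (Suc i) t + \<alpha> (Suc i) t *\<^sub>R u t"
begin

text \<open>Stated conditionally because smoothness and antiperiodicity pass alternately between the
  two families of coefficients in one induction.\<close>

lemma \<beta>_step:
  assumes "smooth (\<alpha> i)" "\<And>t. \<alpha> i (t + pi) = - \<alpha> i t"
  shows "(\<beta> (Suc i) has_real_derivative - (w t * \<alpha> i t)) (at t)"
    and "\<beta> (Suc i) (t + pi) = - \<beta> (Suc i) t" and "smooth (\<beta> (Suc i))"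
proof -
  have c: "continuous_on UNIV (\<lambda>s. \<alpha> i s * w s)"
    using assms(1) w_smooth by (intro continuous_intros smooth_continuous)
  have a: "\<alpha> i (s + pi) * w (s + pi) = - (\<alpha> i s * w s)" for s
    by (simp add: assms(2) w_periodic)
  note * = half_period_integral[OF c a \<beta>_Suc]
  show d: "(\<beta> (Suc i) has_real_derivative - (w t * \<alpha> i t)) (at t)" for t
    using *(1)[of t] by (simp add: mult.commute)
  show "\<beta> (Suc i) (t + pi) = - \<beta> (Suc i) t" by (rule *(2))
  show "smooth (\<beta> (Suc i))"
    using d unfolding has_real_derivative_iff_has_vector_derivative
    by (rule smoothI) (intro smooth_uminus smooth_mult w_smooth assms(1))
qed

lemma \<alpha>_step:
  assumes "smooth (\<beta> (Suc i))" "\<And>t. \<beta> (Suc i) (t + pi) = - \<beta> (Suc i) t"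
  shows "(\<alpha> (Suc i) has_real_derivative z t * \<beta> (Suc i) t) (at t)"
    and "\<alpha> (Suc i) (t + pi) = - \<alpha> (Suc i) t" and "smooth (\<alpha> (Suc i))"
proof -
  have c: "continuous_on UNIV (\<lambda>s. - (\<beta> (Suc i) s * z s))"
    using assms(1) z_smooth by (intro continuous_intros smooth_continuous)
  have a: "- (\<beta> (Suc i) (s + pi) * z (s + pi)) = - (- (\<beta> (Suc i) s * z s))" for s
    by (simp add: assms(2) z_periodic)
  have "\<alpha> (Suc i) t = (1 / 2) * integral {t..t + pi} (\<lambda>s. - (\<beta> (Suc i) s * z s))" for t
    by (simp add: \<alpha>_Suc)
  note * = half_period_integral[OF c a this]
  show d: "(\<alpha> (Suc i) has_real_derivative z t * \<beta> (Suc i) t) (at t)" for t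
    using *(1)[of t] by (simp add: mult.commute)
  show "\<alpha> (Suc i) (t + pi) = - \<alpha> (Suc i) t" by (rule *(2))
  show "smooth (\<alpha> (Suc i))"
    using d unfolding has_real_derivative_iff_has_vector_derivative
    by (rule smoothI) (intro smooth_mult z_smooth assms(1))
qed

lemma \<alpha>_smooth_anti: "smooth (\<alpha> i) \<and> (\<forall>t. \<alpha> i (t + pi) = - \<alpha> i t)"
proof (induction i)
  case (Suc i)
  then show ?case using \<beta>_step[of i] \<alpha>_step[of i] by blast
qed (simp add: \<alpha>0_smooth \<alpha>0_anti)

lemma \<alpha>_smooth: "smooth (\<alpha> i)" and \<alpha>_anti: "\<alpha> i (t + pi) = - \<alpha> i t"
  using \<alpha>_smooth_anti by auto

lemmas \<beta>_deriv = \<beta>_step(1)[OF \<alpha>_smooth \<alpha>_anti]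
  and \<beta>_anti = \<beta>_step(2)[OF \<alpha>_smooth \<alpha>_anti]
  and \<beta>_smooth = \<beta>_step(3)[OF \<alpha>_smooth \<alpha>_anti]
lemmas \<alpha>_deriv = \<alpha>_step(1)[OF \<beta>_smooth \<beta>_anti]

lemma \<alpha>_cont: "continuous_on S (\<alpha> i)" and \<beta>_cont: "continuous_on S (\<beta> (Suc i))"
  by (intro smooth_continuous \<alpha>_smooth \<beta>_smooth)+

text \<open>The derivative of the coefficient, \<open>- w * \<alpha> i\<close>, cancels
  \<open>M'\<close> exactly, leaving only \<open>\<beta> (Suc i) v'\<close>. The same cancellation,
  with the roles exchanged, gives the tangents of the curves \<open>M\<close>.\<close>

lemma N_deriv_if:
  assumes "\<And>t. (M i has_vector_derivative \<alpha> i t *\<^sub>R w t *\<^sub>R v t) (at t)"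
  shows "(N (Suc i) has_vector_derivative - (\<beta> (Suc i) t *\<^sub>R z t *\<^sub>R u t)) (at t)"
proof -
  have "((\<lambda>t. M i t + \<beta> (Suc i) t *\<^sub>R v t) has_vector_derivative
      \<alpha> i t *\<^sub>R w t *\<^sub>R v t + (\<beta> (Suc i) t *\<^sub>R - (z t *\<^sub>R u t) + (- (w t * \<alpha> i t)) *\<^sub>R v t)) (at t)"
    by (intro has_vector_derivative_add has_vector_derivative_scaleR assms \<beta>_deriv v_deriv)
  then show ?thesis
    by (simp add: mult.commute flip: N_Suc)
qed

lemma M_deriv: "(M i has_vector_derivative \<alpha> i t *\<^sub>R w t *\<^sub>R v t) (at t)"
proof (induction i arbitrary: t)
  case (Suc i)
  have "((\<lambda>t. N (Suc i) t + \<alpha> (Suc i) t *\<^sub>R u t) has_vector_derivative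
      - (\<beta> (Suc i) t *\<^sub>R z t *\<^sub>R u t) + (\<alpha> (Suc i) t *\<^sub>R w t *\<^sub>R v t + (z t * \<beta> (Suc i) t) *\<^sub>R u t)) (at t)"
    by (intro has_vector_derivative_add has_vector_derivative_scaleR N_deriv_if Suc \<alpha>_deriv u_deriv)
  then show ?case
    by (simp add: mult.commute flip: M_Suc)
qed (rule M0_deriv)

lemmas N_deriv = N_deriv_if[OF M_deriv]

lemma M_periodic: "M i (t + pi) = M i t"
  by (induction i) (simp_all add: M0_periodic M_Suc N_Suc \<alpha>_anti \<beta>_anti u_anti v_anti)

lemma N_periodic: "N (Suc i) (t + pi) = N (Suc i) t"
  by (simp add: N_Suc M_periodic \<beta>_anti v_anti)

lemma \<alpha>_orthogonal: "integral {0..pi} (\<lambda>t. (w t * \<alpha> i t) *\<^sub>R v t) = 0"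
  using integral_periodic_derivative_zero[OF M_deriv[of i] M_periodic, of 0]
  by (intro integral_unique) (simp add: mult.commute)

lemma \<beta>_orthogonal: "integral {0..pi} (\<lambda>t. (z t * \<beta> (Suc i) t) *\<^sub>R u t) = 0"
  using has_integral_neg[OF integral_periodic_derivative_zero[OF N_deriv[of i] N_periodic, of 0]]
  by (intro integral_unique) (simp add: mult.commute)

section \<open>Geometric decay of the coefficients\<close>

lemma energy_nonneg: "energy (\<alpha> i) \<ge> 0"
  unfolding energy_def using w_pos w_smooth
  by (intro integral_nonneg integrable_continuous_real continuous_intros smooth_continuous \<alpha>_cont)
    (auto intro!: mult_nonneg_nonneg intro: less_imp_le)

lemma energy_decay:
  obtains q where "0 \<le> q" "q < 1" "\<And>i. energy (\<alpha> i) \<le> energy (\<alpha> 0) * q ^ i"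
proof -
  obtain \<kappa> where \<kappa>: "\<kappa> > 0"
    "\<And>y b. \<lbrakk>\<And>t. (y has_real_derivative z t * b t) (at t); continuous_on UNIV b;
       \<And>t. y (t + pi) = - y t; \<And>t. b (t + pi) = - b t;
       integral {0..pi} (\<lambda>t. (w t * y t) *\<^sub>R v t) = 0\<rbrakk>
       \<Longrightarrow> energy y \<le> \<kappa> * (dual_energy b - energy y)"
    using spectral_gap by blast
  \<comment> \<open>Let E and E' be the energies of \<open>\<alpha> i\<close> and
    \<open>\<alpha> (Suc i)\<close>, and D the dual energy between them. The gap E' \<le> \<kappa>
    (D - E') and the estimate 2 D \<le> E + E' combine to (\<kappa> + 2) E' \<le> \<kappa>
    E.\<close>
  define q where "q = \<kappa> / (\<kappa> + 2)"
  have step: "energy (\<alpha> (Suc i)) \<le> q * energy (\<alpha> i)" for i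
  proof -
    note cont = \<alpha>_cont \<beta>_cont smooth_continuous[OF w_smooth] smooth_continuous[OF z_smooth]
    have gap: "energy (\<alpha> (Suc i)) \<le> \<kappa> * (dual_energy (\<beta> (Suc i)) - energy (\<alpha> (Suc i)))"
      by (intro \<kappa>(2) \<alpha>_deriv \<beta>_cont \<alpha>_anti \<beta>_anti \<alpha>_orthogonal)
    \<comment> \<open>Integration by parts: this product has period \<open>pi\<close>, so its
      derivative integrates to 0, and D equals the integral of
      \<open>w * \<alpha> i * \<alpha> (Suc i)\<close>.\<close>
    have "((\<lambda>t. \<beta> (Suc i) t * \<alpha> (Suc i) t) has_real_derivative
        - (w t * \<alpha> i t) * \<alpha> (Suc i) t + z t * \<beta> (Suc i) t * \<beta> (Suc i) t) (at t)" for t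
      by (rule DERIV_mult[OF \<beta>_deriv \<alpha>_deriv])
    then have "((\<lambda>t. z t * (\<beta> (Suc i) t)\<^sup>2 - w t * (\<alpha> i t * \<alpha> (Suc i) t)) has_integral 0) {0..0 + pi}"
      by (intro integral_periodic_derivative_zero[of "\<lambda>t. \<beta> (Suc i) t * \<alpha> (Suc i) t"])
        (auto simp: \<beta>_anti[of _ 0, simplified] \<alpha>_anti[of _ 0, simplified] power2_eq_square algebra_simps
          simp flip: has_real_derivative_iff_has_vector_derivative)
    moreover have "((\<lambda>t. z t * (\<beta> (Suc i) t)\<^sup>2) has_integral dual_energy (\<beta> (Suc i))) {0..pi}"
      unfolding dual_energy_def by (intro integrable_integral integrable_continuous_real continuous_intros cont)
    ultimately have "((\<lambda>t. z t * (\<beta> (Suc i) t)\<^sup>2 - (z t * (\<beta> (Suc i) t)\<^sup>2 - w t * (\<alpha> i t * \<alpha> (Suc i) t)))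
        has_integral dual_energy (\<beta> (Suc i)) - 0) {0..pi}"
      by (intro has_integral_diff) auto
    then have cross: "((\<lambda>t. 2 * (w t * (\<alpha> i t * \<alpha> (Suc i) t))) has_integral 2 * dual_energy (\<beta> (Suc i))) {0..pi}"
      by (intro has_integral_mult_right) simp
    have en: "((\<lambda>t. w t * (\<alpha> j t)\<^sup>2) has_integral energy (\<alpha> j)) {0..pi}" for j
      unfolding energy_def by (intro integrable_integral integrable_continuous_real continuous_intros cont)
    have "2 * dual_energy (\<beta> (Suc i)) \<le> energy (\<alpha> i) + energy (\<alpha> (Suc i))"
    proof (rule has_integral_le[OF cross has_integral_add[OF en en]])
      fix t
      have "0 \<le> w t * (\<alpha> i t - \<alpha> (Suc i) t)\<^sup>2" using w_pos[of t] by simp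
      then show "2 * (w t * (\<alpha> i t * \<alpha> (Suc i) t)) \<le> w t * (\<alpha> i t)\<^sup>2 + w t * (\<alpha> (Suc i) t)\<^sup>2"
        by (simp add: power2_eq_square algebra_simps)
    qed
    then have "\<kappa> * (2 * dual_energy (\<beta> (Suc i))) \<le> \<kappa> * (energy (\<alpha> i) + energy (\<alpha> (Suc i)))"
      using \<kappa>(1) by (intro mult_left_mono) auto
    with gap have "energy (\<alpha> (Suc i)) * (\<kappa> + 2) \<le> \<kappa> * energy (\<alpha> i)"
      by (simp add: algebra_simps)
    then show ?thesis
      using \<kappa>(1) unfolding q_def by (simp add: pos_le_divide_eq)
  qed
  have q: "0 \<le> q" "q < 1" using \<kappa>(1) by (auto simp: q_def)
  have "energy (\<alpha> i) \<le> energy (\<alpha> 0) * q ^ i" for i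
  proof (induction i)
    case (Suc i)
    have "energy (\<alpha> (Suc i)) \<le> q * energy (\<alpha> i)" by (rule step)
    also have "\<dots> \<le> q * (energy (\<alpha> 0) * q ^ i)" using Suc q by (intro mult_left_mono)
    finally show ?case by (simp add: mult_ac)
  qed simp
  then show thesis using that q by blast
qed

text \<open>Each coefficient is a half-period integral of the previous one. Cauchy--Schwarz turns
  the decay of the energy into a pointwise bound for \<beta>, and integrating once more bounds
  \<alpha>.\<close>

lemma coefficients_decay:
  obtains C r where "0 \<le> r" "r < 1"
    "\<And>i t. \<bar>\<beta> (Suc i) t\<bar> \<le> C * r ^ i" "\<And>i t. \<bar>\<alpha> (Suc i) t\<bar> \<le> C * r ^ i"
proof -
  obtain q where q: "0 \<le> q" "q < 1" "\<And>i. energy (\<alpha> i) \<le> energy (\<alpha> 0) * q ^ i"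
    using energy_decay by blast
  define W where "W = integral {0..pi} w"
  have W_pos: "W > 0" unfolding W_def using W_pos[of 0] by simp
  \<comment> \<open>The 4 is the square of the factor 1/2 in the recursion; below, \<open>r\<close>
    is a square root because the energy is quadratic in the coefficients.\<close>
  define B where "B = sqrt (W * energy (\<alpha> 0) / 4)"
  define r where "r = sqrt q"
  have B: "B \<ge> 0" unfolding B_def using W_pos energy_nonneg by simp
  have r: "0 \<le> r" "r < 1" unfolding r_def using q by auto
  have \<beta>_bound: "\<bar>\<beta> (Suc i) t\<bar> \<le> B * r ^ i" for i t
  proof -
    have "integral {t..t + pi} w = W"
      unfolding W_def using w_smooth w_periodic
      by (intro integral_period_shift smooth_continuous) (auto simp: has_period_def)
    moreover have "integral {t..t + pi} (\<lambda>s. w s * (\<alpha> i s)\<^sup>2) = energy (\<alpha> i)"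
      unfolding energy_def using w_smooth
      by (intro integral_period_shift continuous_intros smooth_continuous \<alpha>_cont)
        (auto simp: has_period_def w_periodic \<alpha>_anti)
    ultimately have "(integral {t..t + pi} (\<lambda>s. w s * \<alpha> i s))\<^sup>2 \<le> W * energy (\<alpha> i)"
      using integral_mult_le_squares[of t "t + pi" "\<alpha> i" w] W_pos w_pos
      by (simp add: \<alpha>_cont smooth_continuous[OF w_smooth] less_imp_le)
    then have "(\<beta> (Suc i) t)\<^sup>2 \<le> W * energy (\<alpha> i) / 4"
      by (simp add: \<beta>_Suc power_divide mult.commute)
    also have "\<dots> \<le> W * (energy (\<alpha> 0) * q ^ i) / 4"
      using q(3)[of i] W_pos by (intro divide_right_mono mult_left_mono) auto
    also have "\<dots> = (B * r ^ i)\<^sup>2"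
    proof -
      have "(r ^ i)\<^sup>2 = (r\<^sup>2) ^ i" by (simp add: mult.commute flip: power_mult)
      then show ?thesis
        using W_pos energy_nonneg[of 0] q(1) by (simp add: B_def r_def power_mult_distrib)
    qed
    finally have "(\<beta> (Suc i) t)\<^sup>2 \<le> (B * r ^ i)\<^sup>2" .
    moreover have "0 \<le> B * r ^ i" using B r by simp
    ultimately show ?thesis by (simp only: power2_le_iff_abs_le)
  qed
  have "has_period pi z" by (simp add: has_period_def z_periodic)
  then obtain Z where Z: "Z > 0" "\<And>t. norm (z t) \<le> Z"
    using has_period_bounded[of pi z] smooth_continuous[OF z_smooth] by auto
  have \<alpha>_bound: "\<bar>\<alpha> (Suc i) t\<bar> \<le> (B * Z * pi / 2) * r ^ i" for i t
  proof -
    have "norm (integral {t..t + pi} (\<lambda>s. \<beta> (Suc i) s * z s)) \<le> B * r ^ i * Z * (t + pi - t)"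
    proof (rule integral_bound)
      show "continuous_on {t..t + pi} (\<lambda>s. \<beta> (Suc i) s * z s)"
        using z_smooth by (intro continuous_intros \<beta>_cont smooth_continuous)
      show "norm (\<beta> (Suc i) s * z s) \<le> B * r ^ i * Z" for s
        using \<beta>_bound[of i s] Z B r unfolding norm_mult by (intro mult_mono) auto
    qed simp
    then show ?thesis by (simp add: \<alpha>_Suc field_simps)
  qed
  define C where "C = B + B * Z * pi / 2"
  have C: "B \<le> C" "B * Z * pi / 2 \<le> C" using B Z by (auto simp: C_def)
  show thesis
  proof (rule that[of r C])
    show "\<bar>\<beta> (Suc i) t\<bar> \<le> C * r ^ i" for i t
      by (rule order_trans[OF \<beta>_bound mult_right_mono[OF C(1)]]) (use r in simp)
    show "\<bar>\<alpha> (Suc i) t\<bar> \<le> C * r ^ i" for i t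
      by (rule order_trans[OF \<alpha>_bound mult_right_mono[OF C(2)]]) (use r in simp)
  qed (use r in auto)
qed

lemma uniform_limit_zero_if_geometric:
  fixes F :: "nat \<Rightarrow> real \<Rightarrow> real"
  assumes "0 \<le> r" "r < 1" "\<And>i t. \<bar>F i t\<bar> \<le> C * r ^ i"
  shows "uniform_limit UNIV F (\<lambda>_. 0) sequentially"
proof (rule uniform_limitI)
  fix e :: real assume "e > 0"
  have "(\<lambda>i. C * r ^ i) \<longlonglongrightarrow> C * 0"
    using assms by (intro tendsto_intros LIMSEQ_power_zero) auto
  then have "\<forall>\<^sub>F i in sequentially. C * r ^ i < e"
    using \<open>e > 0\<close> by (intro order_tendstoD(2)) auto
  then show "\<forall>\<^sub>F i in sequentially. \<forall>t\<in>UNIV. dist (F i t) 0 < e"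
    by eventually_elim (use assms(3) in \<open>auto intro: le_less_trans\<close>)
qed

lemma coefficients_limit:
  shows "uniform_limit UNIV \<alpha> (\<lambda>_. 0) sequentially"
    and "uniform_limit UNIV (\<lambda>i. \<beta> (Suc i)) (\<lambda>_. 0) sequentially"
proof -
  obtain C r where r: "0 \<le> r" "r < 1"
    and C: "\<And>i t. \<bar>\<beta> (Suc i) t\<bar> \<le> C * r ^ i" "\<And>i t. \<bar>\<alpha> (Suc i) t\<bar> \<le> C * r ^ i"
    by (rule coefficients_decay, rule that)
  have "uniform_limit UNIV (\<lambda>i. \<alpha> (Suc i)) (\<lambda>_. 0) sequentially"
    by (rule uniform_limit_zero_if_geometric[OF r C(2)])
  then show "uniform_limit UNIV \<alpha> (\<lambda>_. 0) sequentially"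
    by (simp only: uniform_limit_Suc_iff)
  show "uniform_limit UNIV (\<lambda>i. \<beta> (Suc i)) (\<lambda>_. 0) sequentially"
    by (rule uniform_limit_zero_if_geometric[OF r C(1)])
qed

text \<open>The derivative of each coefficient is a periodic factor times a coefficient of the other
  family, so the two claims support each other and only order zero needs an estimate.\<close>

lemma coefficients_null: "null_upto n \<alpha> \<and> null_upto n (\<lambda>i. \<beta> (Suc i))"
proof (induction n)
  have lim: "uniform_limit UNIV \<alpha> (\<lambda>_. 0) sequentially"
    "uniform_limit UNIV (\<lambda>i. \<beta> (Suc i)) (\<lambda>_. 0) sequentially"
    using coefficients_limit .
  {
    case 0
    then show ?case using lim by simp
  next
    case (Suc n)
    have z_period: "has_period pi z" "has_period pi (\<lambda>t. - w t)"
      by (simp_all add: has_period_def z_periodic w_periodic)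
    have "null_upto n (\<lambda>i t. z t * \<beta> (Suc i) t)" "null_upto n (\<lambda>i t. - w t * \<alpha> i t)"
      using Suc
      by (intro null_upto_bilinear[OF bounded_bilinear_mult pi_gt_zero] z_smooth z_period
          \<alpha>_smooth \<beta>_smooth smooth_uminus w_smooth; simp)+
    moreover have "velocity (\<alpha> (Suc i)) = (\<lambda>t. z t * \<beta> (Suc i) t)" for i
      by (intro ext velocity_eqI) (simp add: \<alpha>_deriv flip: has_real_derivative_iff_has_vector_derivative)
    moreover have "velocity (\<beta> (Suc i)) = (\<lambda>t. - w t * \<alpha> i t)" for i
      by (intro ext velocity_eqI) (simp add: \<beta>_deriv flip: has_real_derivative_iff_has_vector_derivative)
    ultimately have "null_upto n (\<lambda>i. velocity (\<alpha> (Suc i)))" "null_upto n (\<lambda>i. velocity (\<beta> (Suc i)))"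
      by simp_all
    then show ?case using lim null_upto_Suc_iff[of n "\<lambda>i. velocity (\<alpha> i)"] by simp
  }
qed

section \<open>Convergence of the curves and the common point\<close>

lemma has_period_u: "has_period (2 * pi) u" and has_period_v: "has_period (2 * pi) v"
  unfolding has_period_def using u_anti v_anti by (metis add.assoc minus_minus mult_2)+

lemma velocity_M_null: "null_upto n (\<lambda>i. velocity (M i))"
  and velocity_N_null: "null_upto n (\<lambda>i. velocity (N (Suc i)))"
proof -
  have w: "has_period (2 * pi) (\<lambda>t. w t *\<^sub>R v t)" "has_period (2 * pi) (\<lambda>t. - (z t *\<^sub>R u t))"
    using has_period_v has_period_u w_periodic z_periodic
    unfolding has_period_def by (metis add.assoc mult_2)+
  have "null_upto n (\<lambda>i t. \<alpha> i t *\<^sub>R w t *\<^sub>R v t)" "null_upto n (\<lambda>i t. \<beta> (Suc i) t *\<^sub>R - (z t *\<^sub>R u t))"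
    using coefficients_null
    by (intro null_upto_bilinear[OF bounded_bilinear.flip[OF bounded_bilinear_scaleR], of "2 * pi"]
        w \<alpha>_smooth \<beta>_smooth smooth_uminus smooth_scaleR w_smooth v_smooth z_smooth u_smooth; simp)+
  moreover have "velocity (M i) = (\<lambda>t. \<alpha> i t *\<^sub>R w t *\<^sub>R v t)" for i
    by (intro ext velocity_eqI M_deriv)
  moreover have "velocity (N (Suc i)) = (\<lambda>t. \<beta> (Suc i) t *\<^sub>R - (z t *\<^sub>R u t))" for i
    using N_deriv by (auto intro!: velocity_eqI)
  ultimately show "null_upto n (\<lambda>i. velocity (M i))" "null_upto n (\<lambda>i. velocity (N (Suc i)))"
    by simp_all
qed

lemma M_smooth: "smooth (M i)"
  using M_deriv by (rule smoothI) (intro smooth_scaleR \<alpha>_smooth w_smooth v_smooth)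

lemma N_smooth: "smooth (N (Suc i))"
  using N_deriv by (rule smoothI) (intro smooth_uminus smooth_scaleR \<beta>_smooth z_smooth u_smooth)

text \<open>The increments are bounded by a geometric series, which yields a limit curve; it is a
  single point because the velocities tend to 0 uniformly.\<close>

lemma M_uniform_limit: obtains p where "uniform_limit UNIV M (\<lambda>_. p) sequentially"
proof -
  obtain C r where r: "0 \<le> r" "r < 1"
    and C: "\<And>i t. \<bar>\<beta> (Suc i) t\<bar> \<le> C * r ^ i" "\<And>i t. \<bar>\<alpha> (Suc i) t\<bar> \<le> C * r ^ i"
    by (rule coefficients_decay, rule that)
  obtain Cu where "Cu > 0" and Cu: "\<And>t. norm (u t) \<le> Cu"
    using has_period_bounded[OF has_period_u] u_cont by auto
  obtain Cv where "Cv > 0" and Cv: "\<And>t. norm (v t) \<le> Cv"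
    using has_period_bounded[OF has_period_v] v_cont by auto
  have C0: "0 \<le> C * r ^ i" for i using C(1)[of i 0] by linarith
  have "norm (M (Suc i) t - M i t) \<le> (C * Cv + C * Cu) * r ^ i" for i t
  proof -
    have "norm (M (Suc i) t - M i t) \<le> \<bar>\<beta> (Suc i) t\<bar> * norm (v t) + \<bar>\<alpha> (Suc i) t\<bar> * norm (u t)"
      using norm_triangle_ineq[of "\<beta> (Suc i) t *\<^sub>R v t" "\<alpha> (Suc i) t *\<^sub>R u t"] by (simp add: M_Suc N_Suc)
    also have "\<dots> \<le> C * r ^ i * Cv + C * r ^ i * Cu"
      using C Cu Cv C0 by (intro add_mono mult_mono) auto
    finally show ?thesis by (simp add: algebra_simps)
  qed
  moreover have "summable (\<lambda>i. (C * Cv + C * Cu) * r ^ i)"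
    using r by (intro summable_mult summable_geometric) auto
  ultimately have "uniform_limit UNIV (\<lambda>n t. \<Sum>i<n. M (Suc i) t - M i t)
      (\<lambda>t. \<Sum>i. M (Suc i) t - M i t) sequentially"
    by (intro Weierstrass_m_test) auto
  from uniform_limit_add[OF uniform_limit_const[where c = "M 0"] this]
  obtain f where "uniform_limit UNIV (\<lambda>n t. M 0 t + (\<Sum>i<n. M (Suc i) t - M i t)) f sequentially"
    by blast
  moreover have "(\<lambda>n t. M 0 t + (\<Sum>i<n. M (Suc i) t - M i t)) = M"
    by (intro ext) (simp add: sum_lessThan_telescope[where f = "\<lambda>i. M i _"])
  ultimately have lim: "uniform_limit UNIV M f sequentially" by simp
  have "uniform_limit UNIV (\<lambda>i. velocity (M i)) (\<lambda>_. 0) sequentially"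
    using velocity_M_null[of 0] by simp
  from uniform_limit_constant_if_derivative_null[OF smooth_has_velocity[OF M_smooth]
      smooth_continuous[OF smooth_velocity[OF M_smooth]] this lim]
  have "uniform_limit UNIV M (\<lambda>_. f 0) sequentially"
    by (rule subst[of _ _ "\<lambda>g. uniform_limit UNIV M g sequentially"]) (rule lim)
  then show thesis by (rule that)
qed

theorem involutes_converge:
  obtains p where "Cinf_converges M (\<lambda>_. p)" "Cinf_converges (\<lambda>i. N (Suc i)) (\<lambda>_. p)"
    "(\<Inter>i. region_bounded_by (M i)) \<inter> (\<Inter>i\<in>{1..}. region_bounded_by (N i)) = {p}"
proof -
  obtain p where M_lim: "uniform_limit UNIV M (\<lambda>_. p) sequentially"
    using M_uniform_limit by blast
  obtain B where "B > 0" and B: "\<And>t. norm (v t) \<le> B"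
    using has_period_bounded[OF has_period_v] v_cont by auto
  from uniform_limit_bilinear_bounded[OF bounded_bilinear.flip[OF bounded_bilinear_scaleR] _ B]
  have "uniform_limit UNIV (\<lambda>i t. \<beta> (Suc i) t *\<^sub>R v t) (\<lambda>_. 0) sequentially"
    using coefficients_null[of 0] by simp
  from uniform_limit_add[OF M_lim this]
  have N_lim: "uniform_limit UNIV (\<lambda>i. N (Suc i)) (\<lambda>_. p) sequentially"
    by (simp flip: N_Suc)
  have p_M: "p \<in> region_bounded_by (M i)" for i
  proof (rule limit_in_regions[OF _ M_periodic _ \<alpha>_cont \<alpha>_orthogonal M_lim])
    show "(M i has_vector_derivative (\<alpha> i t * w t) *\<^sub>R v t) (at t)" for i t
      using M_deriv by simp
    show "M (Suc i) t = M i t + \<beta> (Suc i) t *\<^sub>R v t + \<alpha> (Suc i) t *\<^sub>R u t" for i t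
      by (simp add: M_Suc N_Suc)
  qed
  have "p \<in> region_bounded_by (N (Suc i))" for i
  \<comment> \<open>In the dual pair \<open>- u\<close> is the tangent direction and
    \<open>v\<close> the transversal one. The step from \<open>N (Suc i)\<close> to its successor
    therefore has coefficient \<open>- \<alpha> (Suc i)\<close> along \<open>- u\<close>, and the
    coefficient along \<open>v\<close> must be orthogonal to \<open>u\<close>.\<close>
  proof (rule dual_pair.limit_in_regions[OF dual _ N_periodic _ _ _ N_lim])
    show "(N (Suc i) has_vector_derivative (\<beta> (Suc i) t * z t) *\<^sub>R - u t) (at t)" for i t
      using N_deriv by simp
    show "N (Suc (Suc i)) t = N (Suc i) t + (- \<alpha> (Suc i) t) *\<^sub>R - u t + \<beta> (Suc (Suc i)) t *\<^sub>R v t" for i t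
      by (simp add: M_Suc N_Suc)
    show "continuous_on UNIV (\<beta> (Suc (Suc i)))" for i by (rule \<beta>_cont)
    show "integral {0..pi} (\<lambda>t. (z t * \<beta> (Suc (Suc i)) t) *\<^sub>R - u t) = 0" for i
      using \<beta>_orthogonal[of "Suc i"] by simp
  qed
  then have p_N: "p \<in> region_bounded_by (N i)" if "i \<in> {1..}" for i
    using that by (cases i) auto
  \<comment> \<open>Some \<open>M i\<close> lies in the open ball around \<open>p\<close> whose
    radius is the distance from \<open>p\<close> to \<open>x\<close>. The complement of that ball
    contains \<open>x\<close> and is part of the exterior.\<close>
  have unique: "x = p" if x: "\<And>i. x \<in> region_bounded_by (M i)" for x
  proof (rule ccontr)
    assume "x \<noteq> p"
    then have "\<forall>\<^sub>F i in sequentially. \<forall>t\<in>UNIV. dist (M i t) p < dist x p"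
      by (intro uniform_limitD[OF M_lim]) simp
    then obtain i where "\<forall>t\<in>UNIV. dist (M i t) p < dist x p"
      using eventually_happens'[OF sequentially_bot] by blast
    then have "range (M i) \<subseteq> ball p (dist x p)" by (auto simp: dist_commute)
    then have "- ball p (dist x p) \<subseteq> outside (range (M i))"
      by (intro outside_subset_convex) auto
    moreover have "x \<in> - ball p (dist x p)" by (simp add: dist_commute)
    ultimately show False using x[of i] unfolding region_bounded_by_def by blast
  qed
  show thesis
  proof (rule that[OF Cinf_converges_const[OF M_smooth M_lim velocity_M_null]
        Cinf_converges_const[OF N_smooth N_lim velocity_N_null]])
    show "(\<Inter>i. region_bounded_by (M i)) \<inter> (\<Inter>i\<in>{1..}. region_bounded_by (N i)) = {p}"
      using p_M p_N by (auto intro: unique)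
  qed
qed

end

section \<open>The curves associated with \<open>\<gamma>\<close>\<close>

definition normal_dir :: "real \<Rightarrow> real ^ 2" where
  "normal_dir t = vector [cos t, sin t]"

lemma det2_e_dir: "det2 (e_dir s) (e_dir t) = sin (t - s)"
  by (simp add: det2_eq e_dir_def sin_diff)

lemma det2_normal_e_dir: "det2 (normal_dir t) (e_dir t) = 1"
  by (simp add: det2_eq e_dir_def normal_dir_def power2_eq_square [symmetric])

lemma e_dir_add_pi: "e_dir (t + pi) = - e_dir t"
  by (simp add: e_dir_def vec_eq_iff forall_2)

lemma e_dir_deriv: "(e_dir has_vector_derivative - normal_dir t) (at t)"
proof -
  have eq: "e_dir t = cos t *\<^sub>R vector [0, 1] - sin t *\<^sub>R vector [1, 0]"
    "normal_dir t = cos t *\<^sub>R vector [1, 0] + sin t *\<^sub>R vector [0, 1]" for t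
    by (simp_all add: e_dir_def normal_dir_def vec_eq_iff forall_2)
  have "((\<lambda>t. cos t *\<^sub>R vector [0, 1] - sin t *\<^sub>R vector [1, 0] :: real ^ 2) has_vector_derivative
      (- sin t) *\<^sub>R vector [0, 1] - cos t *\<^sub>R vector [1, 0]) (at t)"
    by (auto intro!: derivative_eq_intros simp flip: has_real_derivative_iff_has_vector_derivative)
  also have "(\<lambda>t. cos t *\<^sub>R vector [0, 1] - sin t *\<^sub>R vector [1, 0]) = e_dir"
    by (rule ext) (rule eq(1)[symmetric])
  also have "(- sin t) *\<^sub>R vector [0, 1] - cos t *\<^sub>R vector [1, 0] = - normal_dir t"
    by (simp add: eq(2))
  finally show ?thesis .
qed

lemma normal_dir_deriv: "(normal_dir has_vector_derivative e_dir t) (at t)"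
proof -
  have eq: "e_dir t = cos t *\<^sub>R vector [0, 1] - sin t *\<^sub>R vector [1, 0]"
    "normal_dir t = cos t *\<^sub>R vector [1, 0] + sin t *\<^sub>R vector [0, 1]" for t
    by (simp_all add: e_dir_def normal_dir_def vec_eq_iff forall_2)
  have "((\<lambda>t. cos t *\<^sub>R vector [1, 0] + sin t *\<^sub>R vector [0, 1] :: real ^ 2) has_vector_derivative
      (- sin t) *\<^sub>R vector [1, 0] + cos t *\<^sub>R vector [0, 1]) (at t)"
    by (auto intro!: derivative_eq_intros simp flip: has_real_derivative_iff_has_vector_derivative)
  then show ?thesis by (simp add: eq algebra_simps flip: eq(2))
qed

text \<open>As the parameter is the tangent angle, the speed \<open>r\<close> is the radius of
  curvature of \<gamma>; its positivity carries the convexity. The smoothness of \<open>r\<close> is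
  not assumed, so later quantities are expressed through \<gamma>.\<close>

locale angle_parametrized =
  fixes \<gamma> :: "real \<Rightarrow> real ^ 2" and k :: real and r :: "real \<Rightarrow> real"
  assumes \<gamma>_smooth: "smooth \<gamma>" and \<gamma>_periodic: "\<gamma> (t + 2 * pi) = \<gamma> t"
    and \<gamma>_velocity: "velocity \<gamma> t = r t *\<^sub>R e_dir t" and r_pos: "r t > 0" and k_pos: "k > 0"
begin

abbreviation "u \<equiv> u_curve \<gamma> k"
abbreviation "v \<equiv> v_curve \<gamma> k"

definition \<rho> :: "real \<Rightarrow> real" where "\<rho> t = k / 2 * (r t + r (t + pi))"
definition w :: "real \<Rightarrow> real" where "w t = det2 (u t) (velocity u t)"
definition z :: "real \<Rightarrow> real" where "z t = det2 (v t) (velocity v t)"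

lemma \<rho>_pos: "\<rho> t > 0"
  using r_pos[of t] r_pos[of "t + pi"] k_pos by (simp add: \<rho>_def)

lemma \<gamma>_shift_deriv: "((\<lambda>t. \<gamma> (t + pi)) has_vector_derivative - (r (t + pi) *\<^sub>R e_dir t)) (at t)"
  unfolding has_vector_derivative_shift_iff
  using smooth_has_velocity[OF \<gamma>_smooth, of "t + pi"] by (simp add: \<gamma>_velocity e_dir_add_pi)

lemma \<gamma>_deriv: "(\<gamma> has_vector_derivative r t *\<^sub>R e_dir t) (at t)"
  using smooth_has_velocity[OF \<gamma>_smooth, of t] by (simp add: \<gamma>_velocity)

lemma u_has_derivative: "(u has_vector_derivative \<rho> t *\<^sub>R e_dir t) (at t)"
proof -
  have "((\<lambda>t. (k / 2) *\<^sub>R (\<gamma> t - \<gamma> (t + pi))) has_vector_derivative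
      (k / 2) *\<^sub>R (r t *\<^sub>R e_dir t - - (r (t + pi) *\<^sub>R e_dir t))) (at t)"
    by (intro bounded_linear.has_vector_derivative[OF bounded_linear_scaleR_right] has_vector_derivative_diff \<gamma>_deriv \<gamma>_shift_deriv)
  moreover have "u = (\<lambda>t. (k / 2) *\<^sub>R (\<gamma> t - \<gamma> (t + pi)))"
    by (auto simp: u_curve_def)
  ultimately show ?thesis by (simp add: \<rho>_def algebra_simps)
qed

lemma velocity_u: "velocity u t = \<rho> t *\<^sub>R e_dir t"
  using u_has_derivative by (rule velocity_eqI)

lemma smooth_scaled: "smooth f \<Longrightarrow> smooth (\<lambda>t. c *\<^sub>R f t)"
  by (rule smooth_scaleR[OF smooth_const])

lemma u_smooth: "smooth u"
proof -
  have "smooth (\<lambda>t. (k / 2) *\<^sub>R (\<gamma> t + - \<gamma> (t + pi)))"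
    by (intro smooth_scaled smooth_add smooth_uminus smooth_shift \<gamma>_smooth)
  then show ?thesis by (simp add: u_curve_def[abs_def])
qed

lemma \<gamma>_two_shifts: "\<gamma> (t + pi + pi) = \<gamma> t"
  using \<gamma>_periodic[of t] by (simp add: add.assoc)

lemma u_antiperiodic: "u (t + pi) = - u t"
  unfolding u_curve_def \<gamma>_two_shifts by (simp add: scaleR_right_diff_distrib)

lemma velocity_u_antiperiodic: "velocity u (t + pi) = - velocity u t"
proof -
  have "velocity u (t + pi) = velocity (\<lambda>t. u (t + pi)) t"
    by (simp add: velocity_shift)
  also have "(\<lambda>t. u (t + pi)) = (\<lambda>t. - u t)" by (simp add: u_antiperiodic)
  also have "velocity \<dots> t = - velocity u t"
    using smooth_has_velocity[OF u_smooth] by (intro velocity_eqI has_vector_derivative_minus)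
  finally show ?thesis .
qed

lemma w_periodic: "w (t + pi) = w t"
  by (simp add: w_def u_antiperiodic velocity_u_antiperiodic)

text \<open>The function \<open>[u, e_dir c]\<close> strictly decreases over the half period after
  \<open>c\<close> and ends at the negative of its initial value, so it starts positive.\<close>

lemma w_pos: "w c > 0"
proof -
  define f where "f t = det2 (u t) (e_dir c)" for t
  have f_deriv: "(f has_real_derivative \<rho> t * sin (c - t)) (at t)" for t
    using det2_has_vector_derivative[OF u_has_derivative[of t] has_vector_derivative_const[of "e_dir c"]]
    unfolding has_real_derivative_iff_has_vector_derivative f_def by (simp add: det2_e_dir)
  have "f (c + pi) < f c"
  proof (rule DERIV_neg_imp_decreasing_open[of c "c + pi"])
    fix x assume x: "c < x" "x < c + pi"
    then have "sin (x - c) > 0" by (intro sin_gt_zero) auto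
    then have "sin (c - x) < 0" using sin_minus[of "x - c"] by simp
    then show "\<exists>d. (f has_real_derivative d) (at x) \<and> d < 0"
      using f_deriv \<rho>_pos[of x] mult_pos_neg by blast
  qed (use f_deriv in \<open>auto intro!: continuous_at_imp_continuous_on DERIV_isCont\<close>)
  then have "f c > 0" by (simp add: f_def u_antiperiodic)
  then show ?thesis
    using \<rho>_pos[of c] by (simp add: w_def velocity_u f_def)
qed

lemma w_smooth: "smooth w"
  unfolding w_def[abs_def] by (intro smooth_det2 smooth_velocity u_smooth)

lemma v_eq: "v t = (1 / w t) *\<^sub>R velocity u t"
  by (simp add: v_curve_def w_def)

lemma v_eq_e_dir: "v t = (\<rho> t / w t) *\<^sub>R e_dir t"
  by (simp add: v_eq velocity_u)

lemma v_smooth: "smooth v"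
proof -
  have "smooth (\<lambda>t. inverse (w t) *\<^sub>R velocity u t)"
    using w_pos by (intro smooth_scaleR smooth_inverse w_smooth smooth_velocity u_smooth)
      (metis less_numeral_extra(3))
  then show ?thesis by (simp add: v_eq[abs_def] inverse_eq_divide)
qed

lemma v_antiperiodic: "v (t + pi) = - v t"
  by (simp add: v_eq w_periodic velocity_u_antiperiodic)

lemma velocity_v_antiperiodic: "velocity v (t + pi) = - velocity v t"
proof -
  have "velocity v (t + pi) = velocity (\<lambda>t. v (t + pi)) t"
    by (simp add: velocity_shift)
  also have "(\<lambda>t. v (t + pi)) = (\<lambda>t. - v t)" by (simp add: v_antiperiodic)
  also have "velocity \<dots> t = - velocity v t"
    using smooth_has_velocity[OF v_smooth] by (intro velocity_eqI has_vector_derivative_minus)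
  finally show ?thesis .
qed

lemma det_u_v: "det2 (u t) (v t) = 1"
  using w_pos[of t] by (simp add: v_eq flip: w_def)

lemma u_deriv: "(u has_vector_derivative w t *\<^sub>R v t) (at t)"
  using smooth_has_velocity[OF u_smooth, of t] w_pos[of t] by (simp add: v_eq)

text \<open>Differentiating \<open>[u, v] = 1\<close> gives \<open>[u, v'] = 0\<close>, because
  \<open>u'\<close> is parallel to \<open>v\<close>. Hence \<open>v'\<close> is a multiple of
  \<open>u\<close>, and pairing with \<open>v\<close> yields the coefficient.\<close>

lemma v_deriv: "(v has_vector_derivative - (z t *\<^sub>R u t)) (at t)"
proof -
  have V: "(v has_vector_derivative velocity v t) (at t)"
    by (rule smooth_has_velocity[OF v_smooth])
  have "((\<lambda>t. det2 (u t) (v t)) has_vector_derivative det2 (u t) (velocity v t)) (at t)"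
    using det2_has_vector_derivative[OF u_deriv V] by simp
  moreover have "((\<lambda>t. det2 (u t) (v t)) has_vector_derivative 0) (at t)"
    by (simp add: det_u_v)
  ultimately have "det2 (u t) (velocity v t) = 0"
    using vector_derivative_unique_at by blast
  then have "velocity v t = - (z t *\<^sub>R u t)"
    using det2_decompose[OF det_u_v[of t], of "velocity v t"] det2_swap[of "v t" "velocity v t"]
    by (simp add: z_def)
  with V show ?thesis by simp
qed

lemma z_pos: "z t > 0"
proof -
  \<comment> \<open>This is the length of \<open>v\<close>. As a determinant it inherits
    differentiability from \<open>v\<close>, and in the moving frame the term with its derivative
    drops out, so that \<open>[v, v']\<close> is its square.\<close>
  define c where "c s = det2 (normal_dir s) (v s)" for s
  have c_eq: "c s = \<rho> s / w s" for s
    by (simp add: c_def v_eq_e_dir det2_normal_e_dir)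
  have V: "(v has_vector_derivative velocity v t) (at t)"
    by (rule smooth_has_velocity[OF v_smooth])
  obtain c' where "(c has_real_derivative c') (at t)"
    unfolding c_def has_real_derivative_iff_has_vector_derivative
    using det2_has_vector_derivative[OF normal_dir_deriv V] by blast
  then have "((\<lambda>s. c s *\<^sub>R e_dir s) has_vector_derivative c t *\<^sub>R - normal_dir t + c' *\<^sub>R e_dir t) (at t)"
    by (intro has_vector_derivative_scaleR e_dir_deriv)
  moreover have "(\<lambda>s. c s *\<^sub>R e_dir s) = v"
    by (simp add: fun_eq_iff c_eq v_eq_e_dir)
  ultimately have "velocity v t = c t *\<^sub>R - normal_dir t + c' *\<^sub>R e_dir t"
    by (intro velocity_eqI) simp
  then have "z t = (c t)\<^sup>2"
    using det2_normal_e_dir[of t] det2_swap[of "e_dir t" "normal_dir t"]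
    by (simp add: z_def v_eq_e_dir power2_eq_square flip: c_eq)
  then show ?thesis
    using \<rho>_pos[of t] w_pos[of t] by (simp add: c_eq)
qed

lemma z_smooth: "smooth z"
  unfolding z_def[abs_def] by (intro smooth_det2 smooth_velocity v_smooth)

lemma z_periodic: "z (t + pi) = z t"
  by (simp add: z_def v_antiperiodic velocity_v_antiperiodic)

lemma det_v_v_pos: "a < b \<Longrightarrow> b < a + pi \<Longrightarrow> det2 (v a) (v b) > 0"
  using \<rho>_pos[of a] \<rho>_pos[of b] w_pos[of a] w_pos[of b] sin_gt_zero[of "b - a"]
  by (simp add: v_eq_e_dir det2_e_dir)

text \<open>
  If \<open>[u a, u]\<close> were not positive at \<open>b\<close>, then its derivative \<open>w [u a, v]\<close> would take a nonpositive
  value before \<open>b\<close> and a nonnegative one after \<open>b\<close>, which is impossible as \<open>v\<close> turns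
  counterclockwise and \<open>[u a, v a] = 1\<close>.
\<close>

lemma det_u_u_pos:
  assumes "a < b" "b < a + pi"
  shows "det2 (u a) (u b) > 0"
proof (rule ccontr)
  define f where "f t = det2 (u a) (u t)" for t
  define q where "q t = det2 (u a) (v t)" for t
  assume "\<not> det2 (u a) (u b) > 0"
  then have fb: "f b \<le> 0" by (simp add: f_def)
  have f_deriv: "(f has_real_derivative w t * q t) (at t)" for t
    using det2_has_vector_derivative[OF has_vector_derivative_const u_deriv, of "u a" t]
    unfolding has_real_derivative_iff_has_vector_derivative f_def q_def by simp
  have f0: "f a = 0" "f (a + pi) = 0" by (simp_all add: f_def u_antiperiodic)
  obtain s where s: "a < s" "s < b" "f b - f a = (b - a) * (w s * q s)"
    using MVT2[OF assms(1) f_deriv] by blast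
  obtain t where t: "b < t" "t < a + pi" "f (a + pi) - f b = (a + pi - b) * (w t * q t)"
    using MVT2[OF assms(2) f_deriv] by blast
  have "(b - a) * w s > 0" "(a + pi - b) * w t > 0"
    using assms w_pos[of s] w_pos[of t] by simp_all
  moreover have "((b - a) * w s) * q s \<le> 0" "((a + pi - b) * w t) * q t \<ge> 0"
    using s(3) t(3) fb f0 by (simp_all add: mult.assoc)
  ultimately have qs: "q s \<le> 0" and qt: "q t \<ge> 0"
    by (metis mult_pos_pos not_less, metis mult_pos_neg not_less)
  \<comment> \<open>The Pluecker relation writes \<open>q s\<close>, up to a positive factor, as a
    positive term plus a positive multiple of \<open>q t\<close>.\<close>
  have "det2 (v a) (v t) * q s = det2 (v s) (v t) + det2 (v a) (v s) * q t"
    using det2_pluecker[of "u a" "v s" "v a" "v t"] det_u_v[of a] det2_swap[of "v s" "v a"]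
    by (simp add: q_def algebra_simps)
  moreover have "det2 (v s) (v t) > 0" "det2 (v a) (v s) > 0" "det2 (v a) (v t) > 0"
    using s t by (intro det_v_v_pos; simp)+
  ultimately have "det2 (v a) (v t) * q s > 0"
    using qt by (simp add: add_pos_nonneg)
  then show False
    using qs \<open>det2 (v a) (v t) > 0\<close> by (simp add: zero_less_mult_iff)
qed

sublocale dual_pair u v w z
  by unfold_locales
    (use u_deriv v_deriv w_smooth z_smooth w_pos z_pos w_periodic z_periodic u_antiperiodic v_antiperiodic
      det_u_v det_u_u_pos det_v_v_pos in \<open>auto intro: smooth_continuous\<close>)

section \<open>The area evolute as initial curve\<close>

lemma M_smooth: "smooth (area_evolute \<gamma>)"
  unfolding area_evolute_def[abs_def]
  by (intro smooth_scaled smooth_add smooth_shift \<gamma>_smooth)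

lemma M_periodic: "area_evolute \<gamma> (t + pi) = area_evolute \<gamma> t"
  unfolding area_evolute_def \<gamma>_two_shifts by (simp add: add.commute)

lemma velocity_M: "velocity (area_evolute \<gamma>) t = ((r t - r (t + pi)) / 2) *\<^sub>R e_dir t"
proof -
  have "((\<lambda>t. (1 / 2) *\<^sub>R (\<gamma> t + \<gamma> (t + pi))) has_vector_derivative
      (1 / 2) *\<^sub>R (r t *\<^sub>R e_dir t + - (r (t + pi) *\<^sub>R e_dir t))) (at t)"
    by (intro bounded_linear.has_vector_derivative[OF bounded_linear_scaleR_right] has_vector_derivative_add \<gamma>_deriv \<gamma>_shift_deriv)
  then show ?thesis
    unfolding area_evolute_def[abs_def] by (intro velocity_eqI) (simp add: algebra_simps diff_divide_distrib)
qed

text \<open>Pairing with \<open>u\<close> resolves the definite description, since \<open>w\<close>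
  does not vanish. Unlike the quotient of speeds, the resulting formula contains only functions
  already known to be smooth.\<close>

lemma alpha_0_eq: "alpha \<gamma> k 0 t = det2 (u t) (velocity (area_evolute \<gamma>) t) * inverse (w t)"
  and velocity_M_eq: "velocity (area_evolute \<gamma>) t = alpha \<gamma> k 0 t *\<^sub>R velocity u t"
proof -
  have ex: "velocity (area_evolute \<gamma>) t = ((r t - r (t + pi)) / 2 / \<rho> t) *\<^sub>R velocity u t"
    using \<rho>_pos[of t] by (simp add: velocity_M velocity_u)
  have *: "a = det2 (u t) (velocity (area_evolute \<gamma>) t) * inverse (w t)"
    if "velocity (area_evolute \<gamma>) t = a *\<^sub>R velocity u t" for a
    using w_pos[of t] by (simp add: that flip: w_def)
  have "alpha \<gamma> k 0 t = (r t - r (t + pi)) / 2 / \<rho> t"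
    unfolding alpha.simps using ex * by (intro the_equality) metis+
  then show "velocity (area_evolute \<gamma>) t = alpha \<gamma> k 0 t *\<^sub>R velocity u t"
    using ex by simp
  then show "alpha \<gamma> k 0 t = det2 (u t) (velocity (area_evolute \<gamma>) t) * inverse (w t)"
    by (rule *)
qed

lemma alpha_0_smooth: "smooth (alpha \<gamma> k 0)"
proof -
  have "smooth (\<lambda>t. det2 (u t) (velocity (area_evolute \<gamma>) t) * inverse (w t))"
    using w_pos by (intro smooth_mult smooth_det2 smooth_inverse w_smooth u_smooth smooth_velocity M_smooth)
      (metis less_numeral_extra(3))
  moreover have "alpha \<gamma> k 0 = (\<lambda>t. det2 (u t) (velocity (area_evolute \<gamma>) t) * inverse (w t))"
    by (rule ext) (rule alpha_0_eq)
  ultimately show ?thesis by (simp only:)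
qed

lemma alpha_0_antiperiodic: "alpha \<gamma> k 0 (t + pi) = - alpha \<gamma> k 0 t"
proof -
  have "has_period pi (area_evolute \<gamma>)" by (simp add: has_period_def M_periodic)
  then have "velocity (area_evolute \<gamma>) (t + pi) = velocity (area_evolute \<gamma>) t"
    using has_period_velocity unfolding has_period_def by blast
  then show ?thesis
    unfolding alpha_0_eq by (simp add: u_antiperiodic w_periodic)
qed

sublocale iterated_involutes u v w z "alpha \<gamma> k" "beta \<gamma> k" "M_inv \<gamma> k" "N_inv \<gamma> k"
proof
  fix t
  show "(M_inv \<gamma> k 0 has_vector_derivative alpha \<gamma> k 0 t *\<^sub>R w t *\<^sub>R v t) (at t)"
    using smooth_has_velocity[OF M_smooth, of t] velocity_M_eq[of t] w_pos[of t]
    by (simp add: v_eq del: alpha.simps)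
qed (use u_smooth v_smooth w_smooth z_smooth alpha_0_smooth alpha_0_antiperiodic M_periodic
    in \<open>simp_all add: w_def z_def del: alpha.simps(1)\<close>)

end

theorem theorem5p1:
  fixes \<gamma> :: "real \<Rightarrow> real ^ 2" and k :: real
  assumes "smooth \<gamma>"
    and "\<And>\<theta>. \<gamma> (\<theta> + 2 * pi) = \<gamma> \<theta>"
    and "inj_on \<gamma> {0..<2 * pi}"
    and "\<And>\<theta>. \<exists>r>0. velocity \<gamma> \<theta> = r *\<^sub>R e_dir \<theta>"
    and "\<And>\<theta>. curvature \<gamma> \<theta> > 0"
    and "convex (region_bounded_by \<gamma>)"
    and "k > 0"
  shows "\<exists>p. O_set \<gamma> k = {p} \<and>
             Cinf_converges (M_inv \<gamma> k) (\<lambda>\<theta>. p) \<and>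
             Cinf_converges (\<lambda>i. N_inv \<gamma> k (Suc i)) (\<lambda>\<theta>. p)"
proof -
  obtain r where "\<And>\<theta>. r \<theta> > 0" "\<And>\<theta>. velocity \<gamma> \<theta> = r \<theta> *\<^sub>R e_dir \<theta>"
    using assms(4) by metis
  then interpret angle_parametrized \<gamma> k r
    using assms(1,2,7) by unfold_locales auto
  obtain p where "Cinf_converges (M_inv \<gamma> k) (\<lambda>_. p)" "Cinf_converges (\<lambda>i. N_inv \<gamma> k (Suc i)) (\<lambda>_. p)"
    "O_set \<gamma> k = {p}"
    using involutes_converge unfolding O_set_def by blast
  then show ?thesis by blast
qed

end
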